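(* Let $R$ be a ring, $M$ a nonzero uniformly finite $R$-module, $N$ a submodule of $M$ with $N\neq M$, and $N=N_1\cap\cdots\cap N_s$ a shortest primary decomposition of $N$ in $M$ with $\operatorname{As}_R(M/N_i)=\{X_i\}$ for $i=1,\ldots,s$. Then: 1. there exist nonzero submodules $W_1,\ldots,W_s$ of $M/N$ such that the sum $W_1+\cdots+W_s$ is direct, $W_1\oplus\cdots\oplus W_s$ is an essential submodule of $M/N$, and $\operatorname{As}_R(W_i)=\{X_i\}$ for each $i=1,\ldots,s$; and 2. (for these $W_1,\ldots,W_s$) for each $i=1,\ldots,s$ there exists a complement $C_i$ of $W_i$ in $M/N$ containing $\sum_{j\neq i}W_j$ such that $\sum_{j\neq i}W_j\subseteq N_i/N\subseteq C_i$. In this way all the shortest primary decompositions of $N$ in $M$ are obtained. In more detail, suppose given 3. any nonzero submodules $W_1',\ldots,W_s'$ of $M/N$ whose sum is direct, such that $W_1'\oplus\cdots\oplus W_s'$ is an essential submodule of $M/N$ and $\operatorname{As}_R(W_i')=\{X_i\}$ for each $i=1,\ldots,s$ (note that $\operatorname{As}_R(M/N)=\{X_1,\ldots,X_s\}$); 4. for each $i=1,\ldots,s$, a complement $C_i'$ of $W_i'$ in $M/N$ that contains $\sum_{j\neq i}W_j'$; 5. for each $i=1,\ldots,s$, a submodule $N_i'$ of $M$ containing $N$ such that $\operatorname{As}_R(M/N_i')=\{X_i\}$ and $\sum_{j\neq i}W_j'\subseteq N_i'/N\subseteq C_i'$. Then $N=N_1'\cap\cdots\cap N_s'$ is a shortest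 primary decomposition of $N$ in $M$.
   Context: Rings have $1$ and need not be commutative; module means left module. A submodule $N$ of $M$ is essential if $N\cap L\neq 0$ for every nonzero submodule $L$ of $M$. A module $U$ is uniform if $U\neq 0$ and every nonzero submodule of $U$ is essential in $U$. A module has finite uniform dimension if it contains no infinite direct sum of nonzero submodules; then $\operatorname{u.dim}(M)$ is the number of summands in any essential direct sum of uniform submodules of $M$ ($0$ if $M=0$). Modules $M_1,M_2$ are essentially equivalent if there are essential submodules $L_1\subseteq M_1$, $L_2\subseteq M_2$ with $L_1\simeq L_2$; $[M]$ denotes the equivalence class of $M$. A left prime of $R$ is the class $[U]$ of a uniform $R$-module $U$. For a module $M$ of finite uniform dimension, $\operatorname{As}_R(M)=\{[U] : U \text{ is a uniform submodule of } M\}$. An $R$-module $M$ is uniformly finite if every factor module of $M$ has finite uniform dimension. A submodule $N$ of $M$ is primary if $\operatorname{u.dim}(M/N)<\infty$ and $\operatorname{As}_R(M/N)$ consists of a single element. A primary decomposition of $N$ in $M$ is an expression $N=N_1\cap\cdots\cap N_s$ ($s\ge 1$ finite) with each $N_i$ a primary submodule of $M$. It is shortest if there is no primary decomposition of $N$ in $M$ with fewer terms. A complement to (or of) a submodule $A$ in a module $Q$ is a submodule $C$ of $Q$ that is maximal with respect to the property $A\cap C=0$. Empty sums of submodules are $0$. *)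

theory Defs
  imports "HOL-Algebra.Module" "HOL-Algebra.AbelCoset"
begin

text \<open>
  The library locale \<^locale>\<open>module\<close> requires a commutative ring. The following is the same
  locale over an arbitrary unital ring. The fields \<^const>\<open>mult\<close> and \<^const>\<open>one\<close> of the module
  record play no role.
\<close>

locale left_module = R?: ring R + M?: abelian_group M
  for R :: "('r, 'x) ring_scheme" (structure) and M :: "('r, 'm) module" (structure) +
  assumes smult_closed [simp, intro]:
      "\<lbrakk>a \<in> carrier R; x \<in> carrier M\<rbrakk> \<Longrightarrow> a \<odot>\<^bsub>M\<^esub> x \<in> carrier M"
    and smult_l_distr:
      "\<lbrakk>a \<in> carrier R; b \<in> carrier R; x \<in> carrier M\<rbrakk> \<Longrightarrow>
      (a \<oplus> b) \<odot>\<^bsub>M\<^esub> x = a \<odot>\<^bsub>M\<^esub> x \<oplus>\<^bsub>M\<^esub> b \<odot>\<^bsub>M\<^esub> x"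
    and smult_r_distr:
      "\<lbrakk>a \<in> carrier R; x \<in> carrier M; y \<in> carrier M\<rbrakk> \<Longrightarrow>
      a \<odot>\<^bsub>M\<^esub> (x \<oplus>\<^bsub>M\<^esub> y) = a \<odot>\<^bsub>M\<^esub> x \<oplus>\<^bsub>M\<^esub> a \<odot>\<^bsub>M\<^esub> y"
    and smult_assoc1:
      "\<lbrakk>a \<in> carrier R; b \<in> carrier R; x \<in> carrier M\<rbrakk> \<Longrightarrow>
      (a \<otimes> b) \<odot>\<^bsub>M\<^esub> x = a \<odot>\<^bsub>M\<^esub> (b \<odot>\<^bsub>M\<^esub> x)"
    and smult_one [simp]:
      "x \<in> carrier M \<Longrightarrow> \<one> \<odot>\<^bsub>M\<^esub> x = x"

text \<open>
  Submodules are carrier sets, as in the library predicate \<^const>\<open>submodule\<close>; the submodule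
  \<open>L\<close> of \<open>M\<close> regarded as a module is \<open>M\<lparr>carrier := L\<rparr>\<close>.
\<close>

text \<open>
  \<open>M/N\<close>, with the cosets of \<open>N\<close> as elements; \<open>r \<odot> A\<close> is the coset \<open>N + r \<odot> a\<close> for any \<open>a \<in> A\<close>.
\<close>

definition quotient_module :: "('r, 'm) module \<Rightarrow> 'm set \<Rightarrow> ('r, 'm set) module" where
  "quotient_module M N =
     \<lparr>carrier = a_rcosets\<^bsub>M\<^esub> N, mult = undefined, one = undefined,
      zero = N, add = set_add M, smult = (\<lambda>r A. \<Union>a\<in>A. N +>\<^bsub>M\<^esub> (r \<odot>\<^bsub>M\<^esub> a))\<rparr>"

text \<open>For \<open>N \<subseteq> L \<subseteq> M\<close>, the subset \<open>L/N\<close> of \<open>M/N\<close>.\<close>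

definition quotient_submodule :: "('r, 'm) module \<Rightarrow> 'm set \<Rightarrow> 'm set \<Rightarrow> 'm set set" where
  "quotient_submodule M L N = carrier (quotient_module (M\<lparr>carrier := L\<rparr>) N)"

definition essential_submodule ::
    "('r, 'x) ring_scheme \<Rightarrow> ('r, 'm) module \<Rightarrow> 'm set \<Rightarrow> bool" where
  "essential_submodule R M N \<longleftrightarrow> submodule N R M \<and>
     (\<forall>L. submodule L R M \<and> L \<noteq> {\<zero>\<^bsub>M\<^esub>} \<longrightarrow> N \<inter> L \<noteq> {\<zero>\<^bsub>M\<^esub>})"

definition uniform_module :: "('r, 'x) ring_scheme \<Rightarrow> ('r, 'm) module \<Rightarrow> bool" where
  "uniform_module R U \<longleftrightarrow> left_module R U \<and> carrier U \<noteq> {\<zero>\<^bsub>U\<^esub>} \<and>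
     (\<forall>L. submodule L R U \<and> L \<noteq> {\<zero>\<^bsub>U\<^esub>} \<longrightarrow> essential_submodule R U L)"

text \<open>The sum of the submodules \<open>L i\<close>, \<open>i \<in> I\<close>: all finite sums of elements of the \<open>L i\<close>.\<close>

definition submodule_sum :: "('r, 'm) module \<Rightarrow> 'i set \<Rightarrow> ('i \<Rightarrow> 'm set) \<Rightarrow> 'm set" where
  "submodule_sum M I L = {finsum M x F | x F. finite F \<and> F \<subseteq> I \<and> (\<forall>i\<in>F. x i \<in> L i)}"

definition direct_family :: "('r, 'm) module \<Rightarrow> 'i set \<Rightarrow> ('i \<Rightarrow> 'm set) \<Rightarrow> bool" where
  "direct_family M I L \<longleftrightarrow> (\<forall>i\<in>I. L i \<inter> submodule_sum M (I - {i}) L = {\<zero>\<^bsub>M\<^esub>})"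

text \<open>
  An infinite direct sum of nonzero submodules is given by an infinite set of submodules, indexed
  by itself: nonzero summands of a direct sum are pairwise distinct.
\<close>

definition finite_uniform_dim :: "('r, 'x) ring_scheme \<Rightarrow> ('r, 'm) module \<Rightarrow> bool" where
  "finite_uniform_dim R M \<longleftrightarrow>
     \<not> (\<exists>S. infinite S \<and> (\<forall>L\<in>S. submodule L R M \<and> L \<noteq> {\<zero>\<^bsub>M\<^esub>}) \<and> direct_family M S (\<lambda>L. L))"

definition left_module_iso ::
    "('r, 'x) ring_scheme \<Rightarrow> ('r, 'm) module \<Rightarrow> ('r, 'n) module \<Rightarrow> bool" where
  "left_module_iso R M M' \<longleftrightarrow> (\<exists>f. bij_betw f (carrier M) (carrier M') \<and>
     (\<forall>x\<in>carrier M. \<forall>y\<in>carrier M. f (x \<oplus>\<^bsub>M\<^esub> y) = f x \<oplus>\<^bsub>M'\<^esub> f y) \<and>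
     (\<forall>r\<in>carrier R. \<forall>x\<in>carrier M. f (r \<odot>\<^bsub>M\<^esub> x) = r \<odot>\<^bsub>M'\<^esub> f x))"

definition essentially_equivalent ::
    "('r, 'x) ring_scheme \<Rightarrow> ('r, 'm) module \<Rightarrow> ('r, 'n) module \<Rightarrow> bool" where
  "essentially_equivalent R M1 M2 \<longleftrightarrow> (\<exists>L1 L2.
     essential_submodule R M1 L1 \<and> essential_submodule R M2 L2 \<and>
     left_module_iso R (M1\<lparr>carrier := L1\<rparr>) (M2\<lparr>carrier := L2\<rparr>))"

text \<open>
  The class \<open>[M]\<close>, cut down to modules whose elements have the same type as those of \<open>M\<close>. For two
  modules with elements of the same type, equality of these sets is essential equivalence.
\<close>

definition essential_class ::
    "('r, 'x) ring_scheme \<Rightarrow> ('r, 'm) module \<Rightarrow> ('r, 'm) module set" where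
  "essential_class R M = {M'. left_module R M' \<and> essentially_equivalent R M M'}"

definition As :: "('r, 'x) ring_scheme \<Rightarrow> ('r, 'm) module \<Rightarrow> ('r, 'm) module set set" where
  "As R M = {essential_class R (M\<lparr>carrier := U\<rparr>) | U.
     submodule U R M \<and> uniform_module R (M\<lparr>carrier := U\<rparr>)}"

definition uniformly_finite :: "('r, 'x) ring_scheme \<Rightarrow> ('r, 'm) module \<Rightarrow> bool" where
  "uniformly_finite R M \<longleftrightarrow>
     (\<forall>N. submodule N R M \<longrightarrow> finite_uniform_dim R (quotient_module M N))"

definition primary_submodule ::
    "('r, 'x) ring_scheme \<Rightarrow> ('r, 'm) module \<Rightarrow> 'm set \<Rightarrow> bool" where
  "primary_submodule R M N \<longleftrightarrow> submodule N R M \<and>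
     finite_uniform_dim R (quotient_module M N) \<and> (\<exists>X. As R (quotient_module M N) = {X})"

definition primary_decomposition ::
    "('r, 'x) ring_scheme \<Rightarrow> ('r, 'm) module \<Rightarrow> 'm set \<Rightarrow> nat \<Rightarrow> (nat \<Rightarrow> 'm set) \<Rightarrow> bool" where
  "primary_decomposition R M N s Ns \<longleftrightarrow> 1 \<le> s \<and>
     (\<forall>i\<in>{1..s}. primary_submodule R M (Ns i)) \<and> N = (\<Inter>i\<in>{1..s}. Ns i)"

definition shortest_primary_decomposition ::
    "('r, 'x) ring_scheme \<Rightarrow> ('r, 'm) module \<Rightarrow> 'm set \<Rightarrow> nat \<Rightarrow> (nat \<Rightarrow> 'm set) \<Rightarrow> bool" where
  "shortest_primary_decomposition R M N s Ns \<longleftrightarrow> primary_decomposition R M N s Ns \<and>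
     (\<forall>t Ns'. primary_decomposition R M N t Ns' \<longrightarrow> s \<le> t)"

definition complement_to ::
    "('r, 'x) ring_scheme \<Rightarrow> ('r, 'm) module \<Rightarrow> 'm set \<Rightarrow> 'm set \<Rightarrow> bool" where
  "complement_to R Q A C \<longleftrightarrow> submodule C R Q \<and> A \<inter> C = {\<zero>\<^bsub>Q\<^esub>} \<and>
     (\<forall>D. submodule D R Q \<and> A \<inter> D = {\<zero>\<^bsub>Q\<^esub>} \<and> C \<subseteq> D \<longrightarrow> D = C)"

text \<open>
  The submodules \<open>W i\<close>, \<open>i \<in> {1..s}\<close>, of \<open>Q\<close> are nonzero, their sum is direct and essential in \<open>Q\<close>,
  and \<open>As (W i) = {X i}\<close>.
\<close>

definition essential_splitting ::
    "('r, 'x) ring_scheme \<Rightarrow> ('r, 'm) module \<Rightarrow> nat \<Rightarrow> (nat \<Rightarrow> ('r, 'm) module set) \<Rightarrow>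
     (nat \<Rightarrow> 'm set) \<Rightarrow> bool" where
  "essential_splitting R Q s X W \<longleftrightarrow>
     (\<forall>i\<in>{1..s}. submodule (W i) R Q \<and> W i \<noteq> {\<zero>\<^bsub>Q\<^esub>}) \<and>
     direct_family Q {1..s} W \<and>
     essential_submodule R Q (submodule_sum Q {1..s} W) \<and>
     (\<forall>i\<in>{1..s}. As R (Q\<lparr>carrier := W i\<rparr>) = {X i})"

end

theory Submission
  imports Defs
begin

text \<open>
  Put \<open>Q = M/N\<close> and \<open>K\<^sub>i = N\<^sub>i/N\<close>. Since the \<open>K\<^sub>i\<close> intersect in \<open>0\<close>, a uniform submodule \<open>U\<close> of \<open>Q\<close>
  meets some \<open>K\<^sub>i\<close> trivially, so it embeds in \<open>M/N\<^sub>i\<close> and \<open>[U] = X\<^sub>i\<close>. In a shortest decomposition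
  no term is redundant and the \<open>X\<^sub>i\<close> are distinct, because terms with the same \<open>X\<^sub>i\<close> can be
  intersected; hence this \<open>i\<close> is unique and \<open>U\<close> meets \<open>W\<^sub>i = \<Inter>\<^sub>j\<^sub>\<noteq>\<^sub>i K\<^sub>j\<close> nontrivially. So the sum of
  the \<open>W\<^sub>i\<close> is essential, and any complement of \<open>W\<^sub>i\<close> containing \<open>K\<^sub>i\<close> serves as \<open>C\<^sub>i\<close>. Conversely,
  distinctness of the \<open>X\<^sub>i\<close> forces a nonzero submodule of \<open>Q\<close> to meet some \<open>W'\<^sub>i\<close> nontrivially,
  while the intersection of the \<open>N'\<^sub>i/N\<close> meets every \<open>W'\<^sub>i\<close> in \<open>0\<close>.

  Only the invariance of \<open>[U]\<close> under isomorphism is ever used, not the transitivity of essential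
  equivalence.
\<close>

section \<open>Submodules, sums and uniform submodules\<close>

context left_module
begin

text \<open>The library predicate \<open>submodule\<close> asks for an additive subgroup. Closure
  under negatives follows from closure under scalars, because the negative of \<open>x\<close> is
  \<open>(\<ominus> \<one>) \<odot> x\<close>.\<close>

lemma submoduleI:
  assumes "H \<subseteq> carrier M" "\<zero>\<^bsub>M\<^esub> \<in> H"
    and "\<And>a b. \<lbrakk>a \<in> H; b \<in> H\<rbrakk> \<Longrightarrow> a \<oplus>\<^bsub>M\<^esub> b \<in> H"
    and sm: "\<And>a x. \<lbrakk>a \<in> carrier R; x \<in> H\<rbrakk> \<Longrightarrow> a \<odot>\<^bsub>M\<^esub> x \<in> H"
  shows "submodule H R M"
proof -
  have "\<ominus>\<^bsub>M\<^esub> x \<in> H" if x: "x \<in> H" for x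
  proof -
    have xc: "x \<in> carrier M" using x assms(1) by blast
    have z: "\<zero> \<odot>\<^bsub>M\<^esub> x = \<zero>\<^bsub>M\<^esub>"
      using smult_l_distr[of \<zero> \<zero> x] xc by (simp add: M.add.l_cancel_one')
    have "(\<ominus> \<one>) \<odot>\<^bsub>M\<^esub> x \<oplus>\<^bsub>M\<^esub> x = \<zero>\<^bsub>M\<^esub>"
      using smult_l_distr[of "\<ominus> \<one>" \<one> x] xc z by (simp add: R.l_neg)
    then have "\<ominus>\<^bsub>M\<^esub> x = (\<ominus> \<one>) \<odot>\<^bsub>M\<^esub> x"
      using xc by (intro M.minus_equality) auto
    then show ?thesis using sm[OF _ x, of "\<ominus> \<one>"] by simp
  qed
  then show ?thesis
    using assms by (intro submodule.intro M.add.subgroupI) (auto simp: submodule_axioms_def)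
qed

lemma submoduleD:
  assumes "submodule H R M"
  shows submodule_subset: "H \<subseteq> carrier M"
    and submodule_zero: "\<zero>\<^bsub>M\<^esub> \<in> H"
    and submodule_add: "\<And>a b. \<lbrakk>a \<in> H; b \<in> H\<rbrakk> \<Longrightarrow> a \<oplus>\<^bsub>M\<^esub> b \<in> H"
    and submodule_neg: "\<And>a. a \<in> H \<Longrightarrow> \<ominus>\<^bsub>M\<^esub> a \<in> H"
    and submodule_smult: "\<And>a x. \<lbrakk>a \<in> carrier R; x \<in> H\<rbrakk> \<Longrightarrow> a \<odot>\<^bsub>M\<^esub> x \<in> H"
proof -
  interpret submodule H R M by fact
  show "H \<subseteq> carrier M" "\<zero>\<^bsub>M\<^esub> \<in> H"
    "\<And>a b. \<lbrakk>a \<in> H; b \<in> H\<rbrakk> \<Longrightarrow> a \<oplus>\<^bsub>M\<^esub> b \<in> H"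
    "\<And>a x. \<lbrakk>a \<in> carrier R; x \<in> H\<rbrakk> \<Longrightarrow> a \<odot>\<^bsub>M\<^esub> x \<in> H"
    using subset one_closed m_closed smult_closed by auto
  show "\<ominus>\<^bsub>M\<^esub> a \<in> H" if "a \<in> H" for a
    using m_inv_closed[OF that] by (simp add: a_inv_def)
qed

lemma smult_zero [simp]:
  assumes "a \<in> carrier R" shows "a \<odot>\<^bsub>M\<^esub> \<zero>\<^bsub>M\<^esub> = \<zero>\<^bsub>M\<^esub>"
  using smult_r_distr[of a "\<zero>\<^bsub>M\<^esub>" "\<zero>\<^bsub>M\<^esub>"] assms by (simp add: M.add.l_cancel_one')

lemma submodule_nonzero_iff:
  assumes "submodule H R M"
  shows "H \<noteq> {\<zero>\<^bsub>M\<^esub>} \<longleftrightarrow> (\<exists>x\<in>H. x \<noteq> \<zero>\<^bsub>M\<^esub>)"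
  using submodule_zero[OF assms] by auto

lemma submodule_carrier: "submodule (carrier M) R M"
  by (rule submoduleI) auto

lemma submodule_Int:
  assumes "submodule A R M" "submodule B R M"
  shows "submodule (A \<inter> B) R M"
  using submoduleD[OF assms(1)] submoduleD[OF assms(2)] by (intro submoduleI) auto

lemma submodule_INT:
  assumes "I \<noteq> {}" "\<And>i. i \<in> I \<Longrightarrow> submodule (K i) R M"
  shows "submodule (\<Inter>i\<in>I. K i) R M"
proof (rule submoduleI)
  show "(\<Inter>i\<in>I. K i) \<subseteq> carrier M" using assms(1) submodule_subset[OF assms(2)] by blast
qed (use submodule_zero[OF assms(2)] submodule_add[OF assms(2)] submodule_smult[OF assms(2)] in simp_all)

section \<open>Submodules regarded as modules, and uniformity inside the ambient module\<close>

lemma left_module_restrict: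
  assumes "submodule U R M"
  shows "left_module R (M\<lparr>carrier := U\<rparr>)"
proof -
  note D = submoduleD[OF assms]
  have "abelian_group (M\<lparr>carrier := U\<rparr>)"
  proof (rule abelian_groupI)
    fix x assume "x \<in> carrier (M\<lparr>carrier := U\<rparr>)"
    then show "\<exists>y\<in>carrier (M\<lparr>carrier := U\<rparr>). y \<oplus>\<^bsub>M\<lparr>carrier := U\<rparr>\<^esub> x = \<zero>\<^bsub>M\<lparr>carrier := U\<rparr>\<^esub>"
      using D by (intro bexI[of _ "\<ominus>\<^bsub>M\<^esub> x"]) (auto simp: M.l_neg subset_iff)
  qed (use D in \<open>auto simp: subset_iff M.a_ac\<close>)
  then interpret U: abelian_group "M\<lparr>carrier := U\<rparr>" .
  show ?thesis
    by unfold_locales (use D in \<open>auto simp: subset_iff smult_l_distr smult_r_distr smult_assoc1\<close>)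
qed

lemma submodule_restrict_iff:
  assumes "submodule U R M"
  shows "submodule A R (M\<lparr>carrier := U\<rparr>) \<longleftrightarrow> submodule A R M \<and> A \<subseteq> U"
proof -
  interpret U: left_module R "M\<lparr>carrier := U\<rparr>" by (rule left_module_restrict[OF assms])
  show ?thesis
  proof
    assume "submodule A R (M\<lparr>carrier := U\<rparr>)"
    from U.submoduleD[OF this] submodule_subset[OF assms]
    show "submodule A R M \<and> A \<subseteq> U" by (auto intro!: submoduleI)
  next
    assume "submodule A R M \<and> A \<subseteq> U"
    then show "submodule A R (M\<lparr>carrier := U\<rparr>)"
      using submoduleD[of A] by (auto intro!: U.submoduleI)
  qed
qed

text \<open>Submodules of \<open>U\<close> are the submodules of \<open>M\<close> contained in
  \<open>U\<close>, so uniformity becomes a symmetric condition on pairs of submodules of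
  \<open>M\<close>, with no restricted module left.\<close>

lemma uniform_restrict_iff:
  assumes "submodule U R M"
  shows "uniform_module R (M\<lparr>carrier := U\<rparr>) \<longleftrightarrow> U \<noteq> {\<zero>\<^bsub>M\<^esub>} \<and>
    (\<forall>A B. submodule A R M \<and> submodule B R M \<and> A \<subseteq> U \<and> B \<subseteq> U \<and>
       A \<noteq> {\<zero>\<^bsub>M\<^esub>} \<and> B \<noteq> {\<zero>\<^bsub>M\<^esub>} \<longrightarrow> A \<inter> B \<noteq> {\<zero>\<^bsub>M\<^esub>})"
  using left_module_restrict[OF assms]
  by (auto simp: uniform_module_def essential_submodule_def submodule_restrict_iff[OF assms])

text \<open>Two nonzero submodules of a uniform module have nonzero intersection; induction on
  \<open>I\<close> extends this to finitely many submodules \<open>U \<inter> K i\<close>. The empty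
  intersection is \<open>UNIV\<close>, so the base case is \<open>U\<close> itself.\<close>

lemma uniform_Int_INT:
  assumes U: "submodule U R M" "uniform_module R (M\<lparr>carrier := U\<rparr>)"
    and "finite I"
    and K: "\<And>i. i \<in> I \<Longrightarrow> submodule (K i) R M" "\<And>i. i \<in> I \<Longrightarrow> U \<inter> K i \<noteq> {\<zero>\<^bsub>M\<^esub>}"
  shows "submodule (U \<inter> (\<Inter>i\<in>I. K i)) R M \<and> U \<inter> (\<Inter>i\<in>I. K i) \<noteq> {\<zero>\<^bsub>M\<^esub>}"
  using assms(3) K
proof (induction I rule: finite_induct)
  case empty
  then show ?case using U by (auto simp: uniform_restrict_iff)
next
  case (insert i I)
  let ?A = "U \<inter> (\<Inter>i\<in>I. K i)"
  have A: "submodule ?A R M" "?A \<noteq> {\<zero>\<^bsub>M\<^esub>}" using insert by auto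
  have B: "submodule (U \<inter> K i) R M" "U \<inter> K i \<noteq> {\<zero>\<^bsub>M\<^esub>}"
    using insert.prems U(1) by (auto intro: submodule_Int)
  have "U \<inter> (\<Inter>i\<in>insert i I. K i) = ?A \<inter> (U \<inter> K i)" by auto
  moreover have "?A \<inter> (U \<inter> K i) \<noteq> {\<zero>\<^bsub>M\<^esub>}"
    using U A B unfolding uniform_restrict_iff[OF U(1)] by (meson inf_le1)
  ultimately show ?case using submodule_Int[OF A(1) B(1)] by simp
qed

section \<open>Sums of submodules\<close>

lemma finsum_in_submodule:
  assumes K: "submodule K R M" and "finite F" "\<And>i. i \<in> F \<Longrightarrow> x i \<in> K"
  shows "finsum M x F \<in> K"
  using assms(2,3)
proof (induction F rule: finite_induct)
  case empty
  then show ?case using submodule_zero[OF K] by simp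
next
  case (insert i F)
  then show ?case
    using submodule_subset[OF K] submodule_add[OF K] by (subst M.finsum_insert) auto
qed

lemma submodule_sum_least:
  assumes "submodule K R M" "\<And>i. i \<in> I \<Longrightarrow> L i \<subseteq> K"
  shows "submodule_sum M I L \<subseteq> K"
  using assms(2) unfolding submodule_sum_def by (blast intro: finsum_in_submodule[OF assms(1)])

lemma submodule_sum_upper:
  assumes "submodule (L i) R M" "i \<in> I"
  shows "L i \<subseteq> submodule_sum M I L"
proof
  fix a assume a: "a \<in> L i"
  then have "a = finsum M (\<lambda>_. a) {i}" using submodule_subset[OF assms(1)] by auto
  then show "a \<in> submodule_sum M I L" using a assms(2) unfolding submodule_sum_def by blast
qed

lemma submodule_sum_mono: "I \<subseteq> J \<Longrightarrow> submodule_sum M I L \<subseteq> submodule_sum M J L"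
  unfolding submodule_sum_def by blast

lemma submodule_sum_empty: "submodule_sum M {} L = {\<zero>\<^bsub>M\<^esub>}"
proof
  show "submodule_sum M {} L \<subseteq> {\<zero>\<^bsub>M\<^esub>}" unfolding submodule_sum_def by auto
  have "\<zero>\<^bsub>M\<^esub> = finsum M undefined {}" by simp
  then show "{\<zero>\<^bsub>M\<^esub>} \<subseteq> submodule_sum M {} L" unfolding submodule_sum_def by blast
qed

lemma zero_in_submodule_sum: "\<zero>\<^bsub>M\<^esub> \<in> submodule_sum M I L"
  using submodule_sum_mono[of "{}" I] unfolding submodule_sum_empty by blast

lemma submodule_set_add:
  assumes A: "submodule A R M" and B: "submodule B R M"
  shows "submodule (A <+>\<^bsub>M\<^esub> B) R M"
proof (rule submoduleI)
  note D = submoduleD[OF A] submoduleD[OF B]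
  show "A <+>\<^bsub>M\<^esub> B \<subseteq> carrier M" using D by (intro M.setadd_subset_G)
  show "\<zero>\<^bsub>M\<^esub> \<in> A <+>\<^bsub>M\<^esub> B" using D(2,7) unfolding set_add_def' by force
  fix x assume "x \<in> A <+>\<^bsub>M\<^esub> B"
  then obtain a b where x: "a \<in> A" "b \<in> B" "x = a \<oplus>\<^bsub>M\<^esub> b" unfolding set_add_def' by auto
  then have c: "a \<in> carrier M" "b \<in> carrier M" using D by auto
  show "r \<odot>\<^bsub>M\<^esub> x \<in> A <+>\<^bsub>M\<^esub> B" if "r \<in> carrier R" for r
    using that c x D(5)[of r a] D(10)[of r b] unfolding set_add_def'
    by (auto simp: smult_r_distr)
  fix y assume "y \<in> A <+>\<^bsub>M\<^esub> B"
  then obtain a' b' where y: "a' \<in> A" "b' \<in> B" "y = a' \<oplus>\<^bsub>M\<^esub> b'" unfolding set_add_def' by auto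
  then have c': "a' \<in> carrier M" "b' \<in> carrier M" using D by auto
  have "x \<oplus>\<^bsub>M\<^esub> y = (a \<oplus>\<^bsub>M\<^esub> a') \<oplus>\<^bsub>M\<^esub> (b \<oplus>\<^bsub>M\<^esub> b')"
    using x y c c' by (simp add: M.a_ac)
  then show "x \<oplus>\<^bsub>M\<^esub> y \<in> A <+>\<^bsub>M\<^esub> B"
    using D(3)[of a a'] D(8)[of b b'] x y unfolding set_add_def' by auto
qed

text \<open>A finite sum splits into its term at \<open>i\<close> and the rest. This reduces finite
  sums of submodules to sums of two, and later isolates a single summand.\<close>

lemma submodule_sum_insert:
  assumes "i \<notin> I" "\<And>j. j \<in> insert i I \<Longrightarrow> submodule (L j) R M"
  shows "submodule_sum M (insert i I) L = submodule_sum M I L <+>\<^bsub>M\<^esub> L i"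
proof (intro subset_antisym subsetI)
  have Lc: "L j \<subseteq> carrier M" if "j \<in> insert i I" for j
    using submodule_subset[OF assms(2)[OF that]] .
  fix z assume "z \<in> submodule_sum M (insert i I) L"
  then obtain x F where z: "z = finsum M x F" "finite F" "F \<subseteq> insert i I" "\<forall>j\<in>F. x j \<in> L j"
    unfolding submodule_sum_def by blast
  have c: "x \<in> F \<rightarrow> carrier M" using z Lc by auto
  let ?a = "finsum M x (F - {i})"
  have a: "?a \<in> submodule_sum M I L" "?a \<in> carrier M"
    using z c unfolding submodule_sum_def by (blast, auto intro!: M.finsum_closed)
  show "z \<in> submodule_sum M I L <+>\<^bsub>M\<^esub> L i"
  proof (cases "i \<in> F")
    case True
    then have "z = x i \<oplus>\<^bsub>M\<^esub> ?a"
      using z c M.finsum_insert[of "F - {i}" i x] by (auto simp: insert_absorb)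
    moreover have "x i \<in> carrier M" using c True by auto
    ultimately have "z = ?a \<oplus>\<^bsub>M\<^esub> x i" using a by (simp add: M.a_comm)
    then show ?thesis using a z True unfolding set_add_def' by blast
  next
    case False
    then have "z = ?a \<oplus>\<^bsub>M\<^esub> \<zero>\<^bsub>M\<^esub>" using z a by auto
    then show ?thesis
      using a submodule_zero[OF assms(2)[of i]] unfolding set_add_def' by blast
  qed
next
  fix z assume "z \<in> submodule_sum M I L <+>\<^bsub>M\<^esub> L i"
  then obtain x F b where z: "z = finsum M x F \<oplus>\<^bsub>M\<^esub> b" "finite F" "F \<subseteq> I" "\<forall>j\<in>F. x j \<in> L j" "b \<in> L i"
    unfolding submodule_sum_def set_add_def' by blast
  have c: "x \<in> F \<rightarrow> carrier M" "b \<in> carrier M"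
    using z submodule_subset[OF assms(2)] by auto
  have F: "i \<notin> F" using z assms(1) by auto
  \<comment> \<open>Both contributions are merged into one family; because
    \<open>i \<notin> F\<close>, overwriting \<open>x\<close> at \<open>i\<close> does not change
    the sum over \<open>F\<close>.\<close>
  have "finsum M (x(i := b)) (insert i F) = b \<oplus>\<^bsub>M\<^esub> finsum M (x(i := b)) F"
    using z c F by (subst M.finsum_insert) auto
  also have "finsum M (x(i := b)) F = finsum M x F"
    using c F by (intro M.finsum_cong') auto
  also have "b \<oplus>\<^bsub>M\<^esub> finsum M x F = z"
    using z c by (simp add: M.a_comm)
  finally have "z = finsum M (x(i := b)) (insert i F)" ..
  moreover have "\<forall>j\<in>insert i F. (x(i := b)) j \<in> L j" using z by auto
  ultimately show "z \<in> submodule_sum M (insert i I) L"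
    using z(2,3) unfolding submodule_sum_def
    by (intro CollectI exI[of _ "x(i := b)"] exI[of _ "insert i F"]) auto
qed

lemma submodule_submodule_sum:
  assumes "finite I" "\<And>j. j \<in> I \<Longrightarrow> submodule (L j) R M"
  shows "submodule (submodule_sum M I L) R M"
  using assms
proof (induction I rule: finite_induct)
  case empty
  show ?case unfolding submodule_sum_empty by (rule submoduleI) auto
next
  case (insert i I)
  then show ?case by (subst submodule_sum_insert) (auto intro: submodule_set_add)
qed

text \<open>Zorn's lemma applied to the submodules that contain \<open>K\<close> and meet
  \<open>A\<close> in zero. The lower bound \<open>K\<close> later allows a complement to be chosen
  above \<open>N_i/N\<close>.\<close>

lemma complement_exists:
  assumes A: "submodule A R M" and K: "submodule K R M" and AK: "A \<inter> K = {\<zero>\<^bsub>M\<^esub>}"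
  obtains C where "complement_to R M A C" "K \<subseteq> C"
proof -
  let ?S = "{D. submodule D R M \<and> A \<inter> D = {\<zero>\<^bsub>M\<^esub>} \<and> K \<subseteq> D}"
  have "\<exists>C\<in>?S. \<forall>D\<in>?S. C \<subseteq> D \<longrightarrow> D = C"
  proof (rule subset_Zorn_nonempty)
    show "?S \<noteq> {}" using K AK by blast
    fix \<C> assume ne: "\<C> \<noteq> {}" and ch: "subset.chain ?S \<C>"
    have sub: "\<And>D. D \<in> \<C> \<Longrightarrow> submodule D R M" and S: "\<And>D. D \<in> \<C> \<Longrightarrow> A \<inter> D = {\<zero>\<^bsub>M\<^esub>} \<and> K \<subseteq> D"
      using ch by (auto simp: subset.chain_def)
    have lin: "\<And>D E. D \<in> \<C> \<Longrightarrow> E \<in> \<C> \<Longrightarrow> D \<subseteq> E \<or> E \<subseteq> D"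
      using ch by (auto simp: subset_chain_def)
    have "submodule (\<Union>\<C>) R M"
    proof (rule submoduleI)
      show "\<Union>\<C> \<subseteq> carrier M" using submodule_subset[OF sub] by blast
      show "\<zero>\<^bsub>M\<^esub> \<in> \<Union>\<C>" using ne submodule_zero[OF sub] by blast
      show "a \<odot>\<^bsub>M\<^esub> x \<in> \<Union>\<C>" if "a \<in> carrier R" "x \<in> \<Union>\<C>" for a x
        using that submodule_smult[OF sub] by blast
      show "a \<oplus>\<^bsub>M\<^esub> b \<in> \<Union>\<C>" if "a \<in> \<Union>\<C>" "b \<in> \<Union>\<C>" for a b
      proof -
        obtain D E where DE: "D \<in> \<C>" "a \<in> D" "E \<in> \<C>" "b \<in> E" using \<open>a \<in> \<Union>\<C>\<close> \<open>b \<in> \<Union>\<C>\<close> by blast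
        then have "\<exists>D\<in>\<C>. a \<in> D \<and> b \<in> D" using lin[of D E] by blast
        then show ?thesis using submodule_add[OF sub] by blast
      qed
    qed
    then show "\<Union>\<C> \<in> ?S" using ne S by blast
  qed
  then obtain C where C: "C \<in> ?S" "\<forall>D\<in>?S. C \<subseteq> D \<longrightarrow> D = C" ..
  then have KC: "K \<subseteq> C" by simp
  \<comment> \<open>Maximality among the submodules containing \<open>K\<close> is enough, because
    any submodule above \<open>C\<close> contains \<open>K\<close> too.\<close>
  then have "complement_to R M A C"
    using C unfolding complement_to_def by (auto dest: order_trans)
  then show ?thesis using KC by (rule that)
qed

text \<open>At the smallest index \<open>m\<close> all the other terms lie in \<open>B m\<close>, so
  the term at \<open>m\<close> is in \<open>A m \<inter> B m\<close> and vanishes. The induction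
  adds indices from the largest downwards.\<close>

lemma decreasing_independent:
  fixes A B :: "nat \<Rightarrow> _"
  assumes A: "\<And>n. submodule (A n) R M" and B: "\<And>n. submodule (B n) R M"
    and AB: "\<And>n. A n \<inter> B n = {\<zero>\<^bsub>M\<^esub>}" "\<And>m n. m < n \<Longrightarrow> A n \<subseteq> B m"
    and "finite G" "\<And>n. n \<in> G \<Longrightarrow> x n \<in> A n" "finsum M x G = \<zero>\<^bsub>M\<^esub>" "n \<in> G"
  shows "x n = \<zero>\<^bsub>M\<^esub>"
  using assms(5-)
proof (induction G arbitrary: n rule: finite_linorder_min_induct)
  case empty
  then show ?case by simp
next
  case (insert m G)
  have c: "x i \<in> carrier M" if "i \<in> insert m G" for i
    using insert.prems(1)[OF that] submodule_subset[OF A] by auto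
  let ?y = "finsum M x G"
  have yB: "?y \<in> B m"
    using insert.hyps insert.prems(1) AB(2) by (intro finsum_in_submodule[OF B]) blast+
  then have yc: "?y \<in> carrier M" using submodule_subset[OF B] by auto
  have s: "x m \<oplus>\<^bsub>M\<^esub> ?y = \<zero>\<^bsub>M\<^esub>"
    using insert.prems(2) insert.hyps c by (subst (asm) M.finsum_insert) auto
  then have "\<ominus>\<^bsub>M\<^esub> ?y = x m" using c yc by (intro M.minus_equality) auto
  then have "x m \<in> A m \<inter> B m" using insert.prems(1) yB submodule_neg[OF B yB] by auto
  then have xm: "x m = \<zero>\<^bsub>M\<^esub>" using AB by auto
  then have "?y = \<zero>\<^bsub>M\<^esub>" using s yc by simp
  then show ?case using insert xm by auto
qed

text \<open>
  If no submodule of \<open>W\<close> were uniform, one could split off nonzero submodules forever: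
  \<open>B\<^sub>0 \<subseteq> W\<close> and \<open>B\<^sub>n \<supseteq> A\<^sub>n\<^sub>+\<^sub>1 \<oplus> B\<^sub>n\<^sub>+\<^sub>1\<close>. The \<open>A\<^sub>n\<close> then form an infinite direct sum.
\<close>

lemma uniform_submodule_exists:
  assumes fin: "finite_uniform_dim R M" and W: "submodule W R M" "W \<noteq> {\<zero>\<^bsub>M\<^esub>}"
  obtains U where "submodule U R M" "U \<subseteq> W" "uniform_module R (M\<lparr>carrier := U\<rparr>)"
proof (rule ccontr)
  assume "\<not> thesis"
  then have nou: "\<And>U. submodule U R M \<Longrightarrow> U \<subseteq> W \<Longrightarrow> \<not> uniform_module R (M\<lparr>carrier := U\<rparr>)"
    using that by blast
  \<comment> \<open>A pair consists of a summand \<open>A\<close> that is split off and a remainder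
    \<open>B\<close> inside \<open>W\<close> that is to be split again.\<close>
  let ?P = "\<lambda>(A, B). submodule A R M \<and> submodule B R M \<and> B \<subseteq> W \<and> A \<noteq> {\<zero>\<^bsub>M\<^esub>} \<and>
    B \<noteq> {\<zero>\<^bsub>M\<^esub>} \<and> A \<inter> B = {\<zero>\<^bsub>M\<^esub>}"
  have split: "\<exists>p. ?P p \<and> fst p \<subseteq> B \<and> snd p \<subseteq> B"
    if B: "submodule B R M" "B \<subseteq> W" "B \<noteq> {\<zero>\<^bsub>M\<^esub>}" for B
  proof -
    \<comment> \<open>For a nonzero \<open>B\<close>, failure of uniformity means exactly that two
      nonzero submodules of \<open>B\<close> intersect in zero.\<close>
    obtain A A' where "submodule A R M \<and> submodule A' R M \<and> A \<subseteq> B \<and> A' \<subseteq> B \<and>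
      A \<noteq> {\<zero>\<^bsub>M\<^esub>} \<and> A' \<noteq> {\<zero>\<^bsub>M\<^esub>} \<and> A \<inter> A' = {\<zero>\<^bsub>M\<^esub>}"
      using nou[OF B(1,2)] B(3) unfolding uniform_restrict_iff[OF B(1)] by blast
    then show ?thesis using B(2) by (intro exI[of _ "(A, A')"]) auto
  qed
  have "\<exists>f. \<forall>n::nat. ?P (f n) \<and> (fst (f (Suc n)) \<subseteq> snd (f n) \<and> snd (f (Suc n)) \<subseteq> snd (f n))"
  proof (rule dependent_nat_choice)
    show "\<exists>p. ?P p" using split[of W] W by blast
    show "\<exists>q. ?P q \<and> (fst q \<subseteq> snd p \<and> snd q \<subseteq> snd p)" if "?P p" for p n
      using split[of "snd p"] that by (auto simp: split_beta)
  qed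
  then obtain f where f_all:
    "\<forall>n::nat. ?P (f n) \<and> (fst (f (Suc n)) \<subseteq> snd (f n) \<and> snd (f (Suc n)) \<subseteq> snd (f n))" ..
  have f: "?P (f n)" "fst (f (Suc n)) \<subseteq> snd (f n)" "snd (f (Suc n)) \<subseteq> snd (f n)" for n
    using f_all[rule_format, of n] by simp_all
  define A where "A n = fst (f n)" for n
  define B where "B n = snd (f n)" for n
  have A: "submodule (A n) R M" "A n \<noteq> {\<zero>\<^bsub>M\<^esub>}" and B: "submodule (B n) R M"
    and AB: "A n \<inter> B n = {\<zero>\<^bsub>M\<^esub>}" for n
    using f(1)[of n] by (auto simp: A_def B_def split_beta)
  have dec: "B n \<subseteq> B m" if "m \<le> n" for m n
    using that f(3) by (induction n rule: dec_induct) (auto simp: B_def)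
  \<comment> \<open>\<open>A n\<close> lies in \<open>B (n - 1)\<close>, one index earlier, and the
    \<open>B\<close> decrease.\<close>
  have AsubB: "A n \<subseteq> B m" if "m < n" for m n
    using that f(2)[of "n - 1"] dec[of m "n - 1"] by (cases n) (auto simp: A_def B_def)
  \<comment> \<open>Injectivity makes the set \<open>range A\<close> infinite and lets sums over it
    be reindexed by natural numbers. If \<open>A m = A n\<close> with \<open>m < n\<close>, then
    \<open>A m \<subseteq> B m\<close>, which forces \<open>A m\<close> to be zero.\<close>
  have inj: "inj A"
  proof (rule linorder_injI)
    fix m n :: nat assume "m < n"
    then show "A m \<noteq> A n" using AsubB[of m n] AB[of m] A(2)[of n] by (metis inf.absorb1)
  qed
  note indep = decreasing_independent[of A B, OF A(1) B AB AsubB]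
  have "direct_family M (range A) (\<lambda>L. L)"
    unfolding direct_family_def
  proof (intro ballI subset_antisym subsetI)
    fix L a assume "L \<in> range A" and a: "a \<in> L \<inter> submodule_sum M (range A - {L}) (\<lambda>L. L)"
    then obtain n where n: "L = A n" by blast
    obtain x F where F: "a = finsum M x F" "finite F" "F \<subseteq> range A - {L}" "\<forall>i\<in>F. x i \<in> i"
      using a unfolding submodule_sum_def by blast
    define G where "G = A -` F"
    have G: "F = A ` G" "finite G" "n \<notin> G" using F n inj by (auto simp: G_def intro: finite_vimageI)
    have ac: "a \<in> A n" "a \<in> carrier M" using a n submodule_subset[OF A(1)] by auto
    have xA: "x (A i) \<in> A i" if "i \<in> G" for i using F G that by auto
    then have xc: "x (A i) \<in> carrier M" if "i \<in> G" for i using that submodule_subset[OF A(1)] by auto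
    have "a = finsum M (\<lambda>i. x (A i)) G"
      unfolding F(1) G(1) using xc inj
      by (intro M.finsum_reindex) (auto intro: inj_on_subset)
    \<comment> \<open>As \<open>n \<notin> G\<close>, the update is invisible on \<open>G\<close>.
      Adding the index \<open>n\<close> then gives a vanishing sum whose term at \<open>n\<close> is
      the negative of \<open>a\<close>, and independence forces \<open>a\<close> to be zero.\<close>
    also have "\<dots> = finsum M ((\<lambda>i. x (A i))(n := \<ominus>\<^bsub>M\<^esub> a)) G"
      using xc G by (intro M.finsum_cong') auto
    finally have "finsum M ((\<lambda>i. x (A i))(n := \<ominus>\<^bsub>M\<^esub> a)) (insert n G) = \<ominus>\<^bsub>M\<^esub> a \<oplus>\<^bsub>M\<^esub> a"
      using G ac xc by (subst M.finsum_insert) auto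
    also have "\<dots> = \<zero>\<^bsub>M\<^esub>" using ac by (simp add: M.l_neg)
    finally have sum0: "finsum M ((\<lambda>i. x (A i))(n := \<ominus>\<^bsub>M\<^esub> a)) (insert n G) = \<zero>\<^bsub>M\<^esub>" .
    have "((\<lambda>i. x (A i))(n := \<ominus>\<^bsub>M\<^esub> a)) n = \<zero>\<^bsub>M\<^esub>"
      using G xA submodule_neg[OF A(1) ac(1)] by (intro indep[OF _ _ _ sum0]) auto
    then have "\<ominus>\<^bsub>M\<^esub> a = \<zero>\<^bsub>M\<^esub>" by simp
    then show "a \<in> {\<zero>\<^bsub>M\<^esub>}" using ac M.minus_minus[of a] by simp
  next
    fix L a assume "L \<in> range A" "a \<in> {\<zero>\<^bsub>M\<^esub>}"
    then show "a \<in> L \<inter> submodule_sum M (range A - {L}) (\<lambda>L. L)"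
      using submodule_zero[OF A(1)] zero_in_submodule_sum by blast
  qed
  moreover have "infinite (range A)" using inj by (simp add: finite_image_iff)
  moreover have "\<forall>L\<in>range A. submodule L R M \<and> L \<noteq> {\<zero>\<^bsub>M\<^esub>}" using A by simp
  ultimately have "\<exists>S. infinite S \<and> (\<forall>L\<in>S. submodule L R M \<and> L \<noteq> {\<zero>\<^bsub>M\<^esub>}) \<and> direct_family M S (\<lambda>L. L)"
    by (intro exI[of _ "range A"] conjI)
  then show False using fin unfolding finite_uniform_dim_def by (rule rev_notE)
qed

end

section \<open>Homomorphisms and left primes\<close>

locale left_module_hom = M: left_module R M + N: left_module R N
  for R :: "('r, 'x) ring_scheme" and M :: "('r, 'm) module" and N :: "('r, 'n) module" +
  fixes f :: "'m \<Rightarrow> 'n"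
  assumes hom_closed: "x \<in> carrier M \<Longrightarrow> f x \<in> carrier N"
    and hom_add: "\<lbrakk>x \<in> carrier M; y \<in> carrier M\<rbrakk> \<Longrightarrow> f (x \<oplus>\<^bsub>M\<^esub> y) = f x \<oplus>\<^bsub>N\<^esub> f y"
    and hom_smult: "\<lbrakk>r \<in> carrier R; x \<in> carrier M\<rbrakk> \<Longrightarrow> f (r \<odot>\<^bsub>M\<^esub> x) = r \<odot>\<^bsub>N\<^esub> f x"
begin

lemma hom_zero: "f \<zero>\<^bsub>M\<^esub> = \<zero>\<^bsub>N\<^esub>"
  using hom_add[of "\<zero>\<^bsub>M\<^esub>" "\<zero>\<^bsub>M\<^esub>"] hom_closed[of "\<zero>\<^bsub>M\<^esub>"] by (simp add: N.M.add.l_cancel_one')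

lemma image_submodule:
  assumes "submodule A R M" shows "submodule (f ` A) R N"
proof (rule N.submoduleI)
  note D = M.submoduleD[OF assms]
  show "f ` A \<subseteq> carrier N" using D(1) hom_closed by auto
  show "\<zero>\<^bsub>N\<^esub> \<in> f ` A" using D(2) hom_zero by force
  show "a \<oplus>\<^bsub>N\<^esub> b \<in> f ` A" if ab: "a \<in> f ` A" "b \<in> f ` A" for a b
  proof -
    obtain x y where "x \<in> A" "y \<in> A" "a = f x" "b = f y" using ab by auto
    then show ?thesis using D(1) D(3)[of x y] hom_add[of x y] by (metis imageI subset_iff)
  qed
  show "a \<odot>\<^bsub>N\<^esub> b \<in> f ` A" if ab: "a \<in> carrier R" "b \<in> f ` A" for a b
  proof -
    obtain y where "y \<in> A" "b = f y" using ab by auto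
    then show ?thesis using ab(1) D(1) D(5)[of a y] hom_smult[of a y] by (metis imageI subset_iff)
  qed
qed

lemma vimage_submodule:
  assumes "submodule B R N" shows "submodule {x \<in> carrier M. f x \<in> B} R M"
  using N.submoduleD[OF assms] hom_zero hom_add hom_smult by (intro M.submoduleI) auto

lemma kernel_submodule: "submodule {x \<in> carrier M. f x = \<zero>\<^bsub>N\<^esub>} R M"
  using hom_zero hom_add hom_smult by (intro M.submoduleI) auto

lemma inj_on_submodule:
  assumes U: "submodule U R M" and ker: "U \<inter> {x \<in> carrier M. f x = \<zero>\<^bsub>N\<^esub>} = {\<zero>\<^bsub>M\<^esub>}"
  shows "inj_on f U"
proof (rule inj_onI)
  fix x y assume xy: "x \<in> U" "y \<in> U" "f x = f y"
  note D = M.submoduleD[OF U]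
  have c: "x \<in> carrier M" "y \<in> carrier M" "\<ominus>\<^bsub>M\<^esub> y \<in> U" using xy D by auto
  have "f (x \<oplus>\<^bsub>M\<^esub> \<ominus>\<^bsub>M\<^esub> y) = f (y \<oplus>\<^bsub>M\<^esub> \<ominus>\<^bsub>M\<^esub> y)"
    using c xy by (simp add: hom_add)
  also have "\<dots> = \<zero>\<^bsub>N\<^esub>" using c by (simp add: M.M.r_neg hom_zero)
  finally have "x \<oplus>\<^bsub>M\<^esub> \<ominus>\<^bsub>M\<^esub> y = \<zero>\<^bsub>M\<^esub>" using ker c xy D(3)[of x "\<ominus>\<^bsub>M\<^esub> y"] by auto
  then show "x = y" using c M.M.minus_equality[of x "\<ominus>\<^bsub>M\<^esub> y"] by simp
qed

end

locale left_module_isomorphism = left_module_hom +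
  assumes hom_bij: "bij_betw f (carrier M) (carrier N)"
begin

lemma hom_inj: "inj_on f (carrier M)" and hom_surj: "f ` carrier M = carrier N"
  using hom_bij by (auto simp: bij_betw_def)

lemma hom_inverse: "left_module_isomorphism R N M (the_inv_into (carrier M) f)"
proof -
  let ?g = "the_inv_into (carrier M) f"
  have gb: "bij_betw ?g (carrier N) (carrier M)" by (rule bij_betw_the_inv_into[OF hom_bij])
  then have gc: "?g y \<in> carrier M" if "y \<in> carrier N" for y using that by (auto simp: bij_betw_def)
  have fg: "f (?g y) = y" if "y \<in> carrier N" for y
    using that f_the_inv_into_f_bij_betw[OF hom_bij] by auto
  have gI: "?g y = x" if "x \<in> carrier M" "f x = y" for x y
    using that the_inv_into_f_eq[OF hom_inj] by blast
  show ?thesis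
  proof unfold_locales
    show "?g y \<in> carrier M" if "y \<in> carrier N" for y using that by (rule gc)
    show "?g (x \<oplus>\<^bsub>N\<^esub> y) = ?g x \<oplus>\<^bsub>M\<^esub> ?g y" if "x \<in> carrier N" "y \<in> carrier N" for x y
      using that gc fg by (intro gI) (simp_all add: hom_add)
    show "?g (r \<odot>\<^bsub>N\<^esub> x) = r \<odot>\<^bsub>M\<^esub> ?g x" if "r \<in> carrier R" "x \<in> carrier N" for r x
      using that gc fg by (intro gI) (simp_all add: hom_smult)
    show "bij_betw ?g (carrier N) (carrier M)" by (rule gb)
  qed
qed

text \<open>Pulling a nonzero submodule \<open>B\<close> of \<open>N\<close> back along
  \<open>f\<close> gives a nonzero submodule, which meets \<open>L\<close>; by injectivity a nonzero
  common element has a nonzero image.\<close>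

lemma essential_image:
  assumes L: "essential_submodule R M L"
  shows "essential_submodule R N (f ` L)"
  unfolding essential_submodule_def
proof (intro conjI allI impI)
  have Ls: "submodule L R M" using L by (simp add: essential_submodule_def)
  show "submodule (f ` L) R N" by (rule image_submodule[OF Ls])
  fix B assume B: "submodule B R N \<and> B \<noteq> {\<zero>\<^bsub>N\<^esub>}"
  let ?A = "{x \<in> carrier M. f x \<in> B}"
  have A: "submodule ?A R M" using B vimage_submodule by blast
  obtain b where b: "b \<in> B" "b \<noteq> \<zero>\<^bsub>N\<^esub>" using B N.submodule_nonzero_iff by blast
  then obtain a where "a \<in> carrier M" "b = f a" using N.submodule_subset B hom_surj by blast
  then have "a \<in> ?A" "a \<noteq> \<zero>\<^bsub>M\<^esub>" using b hom_zero by auto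
  then have "?A \<noteq> {\<zero>\<^bsub>M\<^esub>}" by blast
  then have "L \<inter> ?A \<noteq> {\<zero>\<^bsub>M\<^esub>}" using L A by (simp add: essential_submodule_def)
  then obtain x where x: "x \<in> L" "x \<in> ?A" "x \<noteq> \<zero>\<^bsub>M\<^esub>"
    using M.submodule_nonzero_iff[OF M.submodule_Int[OF Ls A]] by auto
  then have "f x \<noteq> \<zero>\<^bsub>N\<^esub>" using hom_inj hom_zero by (metis (mono_tags) M.M.zero_closed inj_onD mem_Collect_eq)
  then show "f ` L \<inter> B \<noteq> {\<zero>\<^bsub>N\<^esub>}" using x by auto
qed

text \<open>Every nonzero submodule of \<open>N\<close> is the image of its preimage; the preimage
  is nonzero, hence essential in \<open>M\<close>, and images of essential submodules are
  essential.\<close>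

lemma uniform_image:
  assumes "uniform_module R M" shows "uniform_module R N"
  unfolding uniform_module_def
proof (intro conjI allI impI)
  show "left_module R N" by unfold_locales
  have "\<exists>x\<in>carrier M. x \<noteq> \<zero>\<^bsub>M\<^esub>"
    using assms M.M.zero_closed unfolding uniform_module_def by blast
  then obtain x where "x \<in> carrier M" "x \<noteq> \<zero>\<^bsub>M\<^esub>" ..
  then have "f x \<in> carrier N" "f x \<noteq> \<zero>\<^bsub>N\<^esub>"
    using hom_closed inj_onD[OF hom_inj, of x "\<zero>\<^bsub>M\<^esub>"] hom_zero by auto
  then show "carrier N \<noteq> {\<zero>\<^bsub>N\<^esub>}" by blast
  fix B assume B: "submodule B R N \<and> B \<noteq> {\<zero>\<^bsub>N\<^esub>}"
  let ?A = "{x \<in> carrier M. f x \<in> B}"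
  have A: "submodule ?A R M" using B vimage_submodule by blast
  have "B \<subseteq> f ` carrier M" using B N.submodule_subset unfolding hom_surj by blast
  then have img: "f ` ?A = B" by auto
  have "?A \<noteq> {\<zero>\<^bsub>M\<^esub>}"
  proof
    assume "?A = {\<zero>\<^bsub>M\<^esub>}"
    then have "B = {\<zero>\<^bsub>N\<^esub>}" using img hom_zero by simp
    then show False using B by simp
  qed
  then have "essential_submodule R M ?A" using A assms by (simp add: uniform_module_def)
  from essential_image[OF this] show "essential_submodule R N B" unfolding img .
qed

text \<open>The given isomorphism from \<open>L1\<close> to \<open>L2\<close> is composed with the
  inverse of \<open>f\<close>, which moves its domain to the image of \<open>L1\<close>, an
  essential submodule of \<open>N\<close>.\<close>

lemma essentially_equivalent_transfer:
  assumes "essentially_equivalent R M P"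
  shows "essentially_equivalent R N P"
proof -
  obtain L1 L2 g where L: "essential_submodule R M L1" "essential_submodule R P L2"
    and g: "bij_betw g L1 L2"
      "\<And>x y. x \<in> L1 \<Longrightarrow> y \<in> L1 \<Longrightarrow> g (x \<oplus>\<^bsub>M\<^esub> y) = g x \<oplus>\<^bsub>P\<^esub> g y"
      "\<And>r x. r \<in> carrier R \<Longrightarrow> x \<in> L1 \<Longrightarrow> g (r \<odot>\<^bsub>M\<^esub> x) = r \<odot>\<^bsub>P\<^esub> g x"
    using assms unfolding essentially_equivalent_def left_module_iso_def by auto
  have Ls: "submodule L1 R M" using L by (simp add: essential_submodule_def)
  note D = M.submoduleD[OF Ls]
  let ?h = "the_inv_into (carrier M) f"
  have hf: "?h (f x) = x" if "x \<in> carrier M" for x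
    using that the_inv_into_f_f[OF hom_inj] by blast
  have "bij_betw ?h (f ` L1) L1"
    using D(1) hf by (intro bij_betw_byWitness[where f' = f]) (auto simp: subset_iff)
  then have b: "bij_betw (g \<circ> ?h) (f ` L1) L2" using g(1) by (rule bij_betw_trans)
  have "left_module_iso R (N\<lparr>carrier := f ` L1\<rparr>) (P\<lparr>carrier := L2\<rparr>)"
    unfolding left_module_iso_def
  proof (intro exI[of _ "g \<circ> ?h"] conjI ballI; simp)
    show "bij_betw (g \<circ> ?h) (f ` L1) L2" by (rule b)
    fix y assume "y \<in> f ` L1"
    then obtain a where a: "a \<in> L1" "y = f a" by blast
    then have ac: "a \<in> carrier M" using D(1) by blast
    show "g (?h (r \<odot>\<^bsub>N\<^esub> y)) = r \<odot>\<^bsub>P\<^esub> g (?h y)" if "r \<in> carrier R" for r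
      using that a ac g(3) hf hom_smult[of r a, symmetric] by simp
    fix z assume "z \<in> f ` L1"
    then obtain c where c: "c \<in> L1" "z = f c" by blast
    then have cc: "c \<in> carrier M" using D(1) by blast
    show "g (?h (y \<oplus>\<^bsub>N\<^esub> z)) = g (?h y) \<oplus>\<^bsub>P\<^esub> g (?h z)"
      using a ac c cc g(2) hf hom_add[of a c, symmetric] by simp
  qed
  then show ?thesis
    using essential_image[OF L(1)] L(2) unfolding essentially_equivalent_def by blast
qed

end

text \<open>The transfer is applied along \<open>f\<close> and along its inverse. Both modules have
  elements of the same type, so that the two classes can be compared as sets.\<close>

lemma left_module_isomorphism_essential_class:
  fixes R :: "('a, 'b) ring_scheme" and M N :: "('a, 'd) module"
  assumes "left_module_isomorphism R M N f"
  shows "essential_class R M = essential_class R N"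
proof -
  interpret left_module_isomorphism R M N f by fact
  have "essentially_equivalent R M P \<longleftrightarrow> essentially_equivalent R N P"
    for P :: "('a, 'd) module"
    using essentially_equivalent_transfer
      left_module_isomorphism.essentially_equivalent_transfer[OF hom_inverse] by (rule iffI)
  then show ?thesis unfolding essential_class_def by simp
qed

section \<open>\<open>As\<close> of submodules, and left primes under embeddings\<close>

lemma (in left_module) As_restrict:
  assumes "submodule W R M"
  shows "As R (M\<lparr>carrier := W\<rparr>) =
    {essential_class R (M\<lparr>carrier := U\<rparr>) | U.
      submodule U R M \<and> U \<subseteq> W \<and> uniform_module R (M\<lparr>carrier := U\<rparr>)}"
  unfolding As_def submodule_restrict_iff[OF assms] by (simp add: conj_assoc)

lemma (in left_module) As_nonempty:
  assumes "finite_uniform_dim R M" "submodule W R M" "W \<noteq> {\<zero>\<^bsub>M\<^esub>}"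
  shows "As R (M\<lparr>carrier := W\<rparr>) \<noteq> {}"
proof -
  obtain U where "submodule U R M" "U \<subseteq> W" "uniform_module R (M\<lparr>carrier := U\<rparr>)"
    by (rule uniform_submodule_exists[OF assms])
  then have "essential_class R (M\<lparr>carrier := U\<rparr>) \<in> As R (M\<lparr>carrier := W\<rparr>)"
    unfolding As_restrict[OF assms(2)] by blast
  then show ?thesis by blast
qed

text \<open>As \<open>f\<close> is injective on \<open>U\<close>, it is an isomorphism from
  \<open>U\<close> onto its image, and this image is a uniform submodule of \<open>N\<close> of the
  same class.\<close>

lemma As_embedding:
  fixes M N :: "('r, 'm) module"
  assumes "left_module_hom R M N f"
    and U: "submodule U R M" "uniform_module R (M\<lparr>carrier := U\<rparr>)"
    and ker: "U \<inter> {x \<in> carrier M. f x = \<zero>\<^bsub>N\<^esub>} = {\<zero>\<^bsub>M\<^esub>}"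
  shows "essential_class R (M\<lparr>carrier := U\<rparr>) \<in> As R N"
proof -
  interpret left_module_hom R M N f by fact
  have img: "submodule (f ` U) R N" by (rule image_submodule[OF U(1)])
  interpret MU: left_module R "M\<lparr>carrier := U\<rparr>" by (rule M.left_module_restrict[OF U(1)])
  interpret NU: left_module R "N\<lparr>carrier := f ` U\<rparr>" by (rule N.left_module_restrict[OF img])
  have iso: "left_module_isomorphism R (M\<lparr>carrier := U\<rparr>) (N\<lparr>carrier := f ` U\<rparr>) f"
    using M.submodule_subset[OF U(1)] inj_on_submodule[OF U(1) ker]
    by unfold_locales (auto simp: subset_iff hom_add hom_smult bij_betw_def)
  show ?thesis
    using img left_module_isomorphism.uniform_image[OF iso U(2)]
    unfolding left_module_isomorphism_essential_class[OF iso] As_def by blast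
qed

text \<open>The projection of the direct sum of \<open>A\<close> and \<open>B\<close> onto
  \<open>B\<close> has kernel \<open>A\<close>, so it embeds in \<open>B\<close> any submodule
  \<open>U\<close> that meets \<open>A\<close> in zero.\<close>

lemma (in left_module) As_projection:
  assumes A: "submodule A R M" and B: "submodule B R M" and AB: "A \<inter> B = {\<zero>\<^bsub>M\<^esub>}"
    and U: "submodule U R M" "U \<subseteq> A <+>\<^bsub>M\<^esub> B" "uniform_module R (M\<lparr>carrier := U\<rparr>)"
    and UA: "U \<inter> A = {\<zero>\<^bsub>M\<^esub>}"
  shows "essential_class R (M\<lparr>carrier := U\<rparr>) \<in> As R (M\<lparr>carrier := B\<rparr>)"
proof -
  note DA = submoduleD[OF A] and DB = submoduleD[OF B]
  have S: "submodule (A <+>\<^bsub>M\<^esub> B) R M" by (rule submodule_set_add[OF A B])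
  interpret MS: left_module R "M\<lparr>carrier := A <+>\<^bsub>M\<^esub> B\<rparr>" by (rule left_module_restrict[OF S])
  interpret MB: left_module R "M\<lparr>carrier := B\<rparr>" by (rule left_module_restrict[OF B])
  define p where "p x = (THE b. b \<in> B \<and> (\<exists>a\<in>A. x = a \<oplus>\<^bsub>M\<^esub> b))" for x
  have p: "p (a \<oplus>\<^bsub>M\<^esub> b) = b" if ab: "a \<in> A" "b \<in> B" for a b
    unfolding p_def
  proof (rule the_equality)
    show "b \<in> B \<and> (\<exists>a'\<in>A. a \<oplus>\<^bsub>M\<^esub> b = a' \<oplus>\<^bsub>M\<^esub> b)" using ab by blast
    fix b' assume "b' \<in> B \<and> (\<exists>a'\<in>A. a \<oplus>\<^bsub>M\<^esub> b = a' \<oplus>\<^bsub>M\<^esub> b')"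
    then obtain a' where ab': "a' \<in> A" "b' \<in> B" "a \<oplus>\<^bsub>M\<^esub> b = a' \<oplus>\<^bsub>M\<^esub> b'" by blast
    have c: "a \<in> carrier M" "b \<in> carrier M" "a' \<in> carrier M" "b' \<in> carrier M"
      using ab ab' DA DB by auto
    \<comment> \<open>Uniqueness of the component in \<open>B\<close>: from
      \<open>a + b = a' + b'\<close> the element \<open>b' - b = a - a'\<close> lies in
      \<open>A \<inter> B\<close>.\<close>
    have "b' \<oplus>\<^bsub>M\<^esub> \<ominus>\<^bsub>M\<^esub> b = (\<ominus>\<^bsub>M\<^esub> a' \<oplus>\<^bsub>M\<^esub> (a' \<oplus>\<^bsub>M\<^esub> b')) \<oplus>\<^bsub>M\<^esub> \<ominus>\<^bsub>M\<^esub> b"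
      using c by (simp add: M.r_neg1)
    also have "\<dots> = \<ominus>\<^bsub>M\<^esub> a' \<oplus>\<^bsub>M\<^esub> (a \<oplus>\<^bsub>M\<^esub> (b \<oplus>\<^bsub>M\<^esub> \<ominus>\<^bsub>M\<^esub> b))"
      unfolding ab'(3)[symmetric] using c by (simp add: M.a_assoc)
    also have "\<dots> = \<ominus>\<^bsub>M\<^esub> a' \<oplus>\<^bsub>M\<^esub> a" using c by (simp add: M.r_neg)
    finally have e: "b' \<oplus>\<^bsub>M\<^esub> \<ominus>\<^bsub>M\<^esub> b = \<ominus>\<^bsub>M\<^esub> a' \<oplus>\<^bsub>M\<^esub> a" .
    have "b' \<oplus>\<^bsub>M\<^esub> \<ominus>\<^bsub>M\<^esub> b \<in> B" using ab ab' DB by blast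
    moreover have "\<ominus>\<^bsub>M\<^esub> a' \<oplus>\<^bsub>M\<^esub> a \<in> A" using ab ab' DA by blast
    ultimately have "b' \<oplus>\<^bsub>M\<^esub> \<ominus>\<^bsub>M\<^esub> b = \<zero>\<^bsub>M\<^esub>" using AB e by auto
    then show "b' = b" using c M.minus_equality[of b' "\<ominus>\<^bsub>M\<^esub> b"] by simp
  qed
  have dec: "\<exists>a\<in>A. \<exists>b\<in>B. x = a \<oplus>\<^bsub>M\<^esub> b" if "x \<in> A <+>\<^bsub>M\<^esub> B" for x
    using that unfolding set_add_def' by blast
  have "left_module_hom R (M\<lparr>carrier := A <+>\<^bsub>M\<^esub> B\<rparr>) (M\<lparr>carrier := B\<rparr>) p"
  proof (unfold_locales, simp_all)
    fix x assume x: "x \<in> A <+>\<^bsub>M\<^esub> B"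
    then obtain a b where ab: "a \<in> A" "b \<in> B" "x = a \<oplus>\<^bsub>M\<^esub> b" using dec by blast
    then have c: "a \<in> carrier M" "b \<in> carrier M" using DA DB by auto
    show "p x \<in> B" using p ab by simp
    show "p (r \<odot>\<^bsub>M\<^esub> x) = r \<odot>\<^bsub>M\<^esub> p x" if "r \<in> carrier R" for r
      using that ab c p[of a b] p[of "r \<odot>\<^bsub>M\<^esub> a" "r \<odot>\<^bsub>M\<^esub> b"] DA(5) DB(5) by (simp add: smult_r_distr)
    fix y assume "y \<in> A <+>\<^bsub>M\<^esub> B"
    then obtain a' b' where ab': "a' \<in> A" "b' \<in> B" "y = a' \<oplus>\<^bsub>M\<^esub> b'" using dec by blast
    then have c': "a' \<in> carrier M" "b' \<in> carrier M" using DA DB by auto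
    have "x \<oplus>\<^bsub>M\<^esub> y = (a \<oplus>\<^bsub>M\<^esub> a') \<oplus>\<^bsub>M\<^esub> (b \<oplus>\<^bsub>M\<^esub> b')"
      using ab ab' c c' by (simp add: M.a_ac)
    then show "p (x \<oplus>\<^bsub>M\<^esub> y) = p x \<oplus>\<^bsub>M\<^esub> p y" using p ab ab' DA(3) DB(3) by simp
  qed
  moreover have "U \<inter> {x \<in> A <+>\<^bsub>M\<^esub> B. p x = \<zero>\<^bsub>M\<^esub>} = {\<zero>\<^bsub>M\<^esub>}"
  proof (intro subset_antisym subsetI)
    fix x assume x: "x \<in> U \<inter> {x \<in> A <+>\<^bsub>M\<^esub> B. p x = \<zero>\<^bsub>M\<^esub>}"
    then obtain a b where ab: "a \<in> A" "b \<in> B" "x = a \<oplus>\<^bsub>M\<^esub> b" using dec by blast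
    then have "x = a" using x p DA by auto
    then show "x \<in> {\<zero>\<^bsub>M\<^esub>}" using UA x ab by blast
  next
    fix x assume "x \<in> {\<zero>\<^bsub>M\<^esub>}"
    moreover have "p \<zero>\<^bsub>M\<^esub> = \<zero>\<^bsub>M\<^esub>" using p[OF DA(2) DB(2)] by simp
    ultimately show "x \<in> U \<inter> {x \<in> A <+>\<^bsub>M\<^esub> B. p x = \<zero>\<^bsub>M\<^esub>}"
      using submodule_zero[OF U(1)] submodule_zero[OF S] by simp
  qed
  ultimately show ?thesis
    using As_embedding[of R "M\<lparr>carrier := A <+>\<^bsub>M\<^esub> B\<rparr>" "M\<lparr>carrier := B\<rparr>" p U] U
    by (simp add: submodule_restrict_iff[OF S])
qed

section \<open>Quotient modules\<close>

context left_module
begin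

lemma abelian_subgroup_submodule:
  assumes "submodule H R M" shows "abelian_subgroup H M"
  using assms M.abelian_group_axioms
  by (intro abelian_subgroupI3 additive_subgroupI) (auto simp: submodule_def)

lemma submodule_set_add_absorb:
  assumes "submodule N R M" "submodule L R M" "N \<subseteq> L"
  shows "L <+>\<^bsub>M\<^esub> N = L"
proof
  note D = submoduleD[OF assms(2)]
  show "L <+>\<^bsub>M\<^esub> N \<subseteq> L" using D(3) assms(3) unfolding set_add_def' by blast
  show "L \<subseteq> L <+>\<^bsub>M\<^esub> N"
  proof
    fix x assume x: "x \<in> L"
    then have "x = x \<oplus>\<^bsub>M\<^esub> \<zero>\<^bsub>M\<^esub>" using D(1) by auto
    then show "x \<in> L <+>\<^bsub>M\<^esub> N" using x submodule_zero[OF assms(1)] unfolding set_add_def' by blast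
  qed
qed

lemma rcoset_self:
  assumes "submodule N R M" "x \<in> carrier M" shows "x \<in> N +>\<^bsub>M\<^esub> x"
  using abelian_subgroup.a_rcos_self[OF abelian_subgroup_submodule[OF assms(1)] assms(2)] .

lemma rcoset_eqI:
  assumes "submodule N R M" "y \<in> N +>\<^bsub>M\<^esub> x" "x \<in> carrier M"
  shows "N +>\<^bsub>M\<^esub> y = N +>\<^bsub>M\<^esub> x"
  using abelian_subgroup.a_repr_independence'[OF abelian_subgroup_submodule[OF assms(1)] assms(2,3)] ..

lemma rcoset_zero_iff:
  assumes N: "submodule N R M" and x: "x \<in> carrier M"
  shows "N +>\<^bsub>M\<^esub> x = N \<longleftrightarrow> x \<in> N"
proof
  assume "N +>\<^bsub>M\<^esub> x = N"
  then show "x \<in> N" using rcoset_self[OF assms] by simp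
next
  assume "x \<in> N"
  then show "N +>\<^bsub>M\<^esub> x = N"
    using M.a_coset_join2[OF x] N by (simp add: submodule_def)
qed

lemma carrier_quotient: "carrier (quotient_module M N) = {N +>\<^bsub>M\<^esub> x | x. x \<in> carrier M}"
  unfolding quotient_module_def A_RCOSETS_def' by auto

lemma zero_quotient [simp]: "\<zero>\<^bsub>quotient_module M N\<^esub> = N"
  unfolding quotient_module_def by simp

lemma quotient_submodule_eq: "quotient_submodule M L N = {N +>\<^bsub>M\<^esub> x | x. x \<in> L}"
  unfolding quotient_submodule_def quotient_module_def A_RCOSETS_def' a_r_coset_def' by auto

lemma add_quotient:
  assumes "submodule N R M" "x \<in> carrier M" "y \<in> carrier M"
  shows "(N +>\<^bsub>M\<^esub> x) \<oplus>\<^bsub>quotient_module M N\<^esub> (N +>\<^bsub>M\<^esub> y) = N +>\<^bsub>M\<^esub> (x \<oplus>\<^bsub>M\<^esub> y)"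
  using abelian_subgroup.a_rcos_sum[OF abelian_subgroup_submodule[OF assms(1)] assms(2,3)]
  unfolding quotient_module_def by simp

lemma smult_quotient:
  assumes N: "submodule N R M" and r: "r \<in> carrier R" and x: "x \<in> carrier M"
  shows "r \<odot>\<^bsub>quotient_module M N\<^esub> (N +>\<^bsub>M\<^esub> x) = N +>\<^bsub>M\<^esub> (r \<odot>\<^bsub>M\<^esub> x)"
proof -
  \<comment> \<open>The scalar multiple of a coset is defined as a union over its elements
    \<open>y\<close>. All sets in this union are the same coset, since \<open>r y\<close> and
    \<open>r x\<close> differ by an element of \<open>N\<close>, so the union collapses.\<close>
  have eq: "N +>\<^bsub>M\<^esub> (r \<odot>\<^bsub>M\<^esub> y) = N +>\<^bsub>M\<^esub> (r \<odot>\<^bsub>M\<^esub> x)" if y: "y \<in> N +>\<^bsub>M\<^esub> x" for y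
  proof -
    obtain n where n: "n \<in> N" "y = n \<oplus>\<^bsub>M\<^esub> x" using y unfolding a_r_coset_def' by auto
    then have "r \<odot>\<^bsub>M\<^esub> y = r \<odot>\<^bsub>M\<^esub> n \<oplus>\<^bsub>M\<^esub> r \<odot>\<^bsub>M\<^esub> x"
      using r x submodule_subset[OF N] by (auto simp: smult_r_distr)
    then have "r \<odot>\<^bsub>M\<^esub> y \<in> N +>\<^bsub>M\<^esub> (r \<odot>\<^bsub>M\<^esub> x)"
      using submodule_smult[OF N r n(1)] unfolding a_r_coset_def' by auto
    then show ?thesis using r x by (intro rcoset_eqI[OF N]) auto
  qed
  have ne: "N +>\<^bsub>M\<^esub> x \<noteq> {}" using rcoset_self[OF N x] by blast
  have "(\<Union>y\<in>N +>\<^bsub>M\<^esub> x. N +>\<^bsub>M\<^esub> (r \<odot>\<^bsub>M\<^esub> y)) = (\<Union>y\<in>N +>\<^bsub>M\<^esub> x. N +>\<^bsub>M\<^esub> (r \<odot>\<^bsub>M\<^esub> x))"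
    using eq by (intro SUP_cong refl)
  also have "\<dots> = N +>\<^bsub>M\<^esub> (r \<odot>\<^bsub>M\<^esub> x)" using ne by simp
  finally show ?thesis unfolding quotient_module_def by simp
qed

lemma left_module_quotient:
  assumes N: "submodule N R M"
  shows "left_module R (quotient_module M N)"
proof -
  let ?Q = "quotient_module M N"
  note ops = add_quotient[OF N] smult_quotient[OF N]
  \<comment> \<open>Written as the coset of zero, the zero element falls under the same rule for
    sums of cosets as all others.\<close>
  have zero: "N = N +>\<^bsub>M\<^esub> \<zero>\<^bsub>M\<^esub>"
    using rcoset_zero_iff[OF N, of "\<zero>\<^bsub>M\<^esub>"] submodule_zero[OF N] by simp
  have ex: "\<exists>a\<in>carrier M. x = N +>\<^bsub>M\<^esub> a" if "x \<in> carrier ?Q" for x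
    using that unfolding carrier_quotient by blast
  have in_carrier: "N +>\<^bsub>M\<^esub> a \<in> carrier ?Q" if "a \<in> carrier M" for a
    using that unfolding carrier_quotient by blast
  have "abelian_group ?Q"
  proof (rule abelian_groupI)
    show "\<zero>\<^bsub>?Q\<^esub> \<in> carrier ?Q" using in_carrier[of "\<zero>\<^bsub>M\<^esub>"] zero by simp
    fix x assume "x \<in> carrier ?Q"
    then obtain a where a: "a \<in> carrier M" "x = N +>\<^bsub>M\<^esub> a" using ex by blast
    have "\<zero>\<^bsub>?Q\<^esub> \<oplus>\<^bsub>?Q\<^esub> x = (N +>\<^bsub>M\<^esub> \<zero>\<^bsub>M\<^esub>) \<oplus>\<^bsub>?Q\<^esub> (N +>\<^bsub>M\<^esub> a)"
      using zero a by simp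
    also have "\<dots> = x" using a by (simp add: ops del: M.a_coset_add_zero)
    finally show "\<zero>\<^bsub>?Q\<^esub> \<oplus>\<^bsub>?Q\<^esub> x = x" .
    have "(N +>\<^bsub>M\<^esub> (\<ominus>\<^bsub>M\<^esub> a)) \<oplus>\<^bsub>?Q\<^esub> x = \<zero>\<^bsub>?Q\<^esub>"
      using a zero by (simp add: ops M.l_neg)
    then show "\<exists>y\<in>carrier ?Q. y \<oplus>\<^bsub>?Q\<^esub> x = \<zero>\<^bsub>?Q\<^esub>" using in_carrier a by blast
    fix y assume "y \<in> carrier ?Q"
    then obtain b where b: "b \<in> carrier M" "y = N +>\<^bsub>M\<^esub> b" using ex by blast
    show "x \<oplus>\<^bsub>?Q\<^esub> y \<in> carrier ?Q" using a b in_carrier by (simp add: ops)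
    show "x \<oplus>\<^bsub>?Q\<^esub> y = y \<oplus>\<^bsub>?Q\<^esub> x" using a b by (simp add: ops M.a_comm)
    fix z assume "z \<in> carrier ?Q"
    then obtain c where c: "c \<in> carrier M" "z = N +>\<^bsub>M\<^esub> c" using ex by blast
    show "x \<oplus>\<^bsub>?Q\<^esub> y \<oplus>\<^bsub>?Q\<^esub> z = x \<oplus>\<^bsub>?Q\<^esub> (y \<oplus>\<^bsub>?Q\<^esub> z)"
      using a b c by (simp add: ops M.a_assoc)
  qed
  then interpret Q: abelian_group ?Q .
  show ?thesis
  proof unfold_locales
    fix r x assume r: "r \<in> carrier R" and x: "x \<in> carrier ?Q"
    obtain a where a: "a \<in> carrier M" "x = N +>\<^bsub>M\<^esub> a" using ex x by blast
    show "r \<odot>\<^bsub>?Q\<^esub> x \<in> carrier ?Q" using r a in_carrier by (simp add: ops)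
    show "(r \<oplus> t) \<odot>\<^bsub>?Q\<^esub> x = r \<odot>\<^bsub>?Q\<^esub> x \<oplus>\<^bsub>?Q\<^esub> t \<odot>\<^bsub>?Q\<^esub> x" if "t \<in> carrier R" for t
      using r a that by (simp add: ops smult_l_distr)
    show "r \<otimes> t \<odot>\<^bsub>?Q\<^esub> x = r \<odot>\<^bsub>?Q\<^esub> (t \<odot>\<^bsub>?Q\<^esub> x)" if "t \<in> carrier R" for t
      using r a that by (simp add: ops smult_assoc1)
    fix y assume y: "y \<in> carrier ?Q"
    obtain b where b: "b \<in> carrier M" "y = N +>\<^bsub>M\<^esub> b" using ex y by blast
    show "r \<odot>\<^bsub>?Q\<^esub> (x \<oplus>\<^bsub>?Q\<^esub> y) = r \<odot>\<^bsub>?Q\<^esub> x \<oplus>\<^bsub>?Q\<^esub> r \<odot>\<^bsub>?Q\<^esub> y"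
      using r a b by (simp add: ops smult_r_distr)
  next
    fix x assume x: "x \<in> carrier ?Q"
    obtain a where a: "a \<in> carrier M" "x = N +>\<^bsub>M\<^esub> a" using ex x by blast
    show "\<one> \<odot>\<^bsub>?Q\<^esub> x = x" using a by (simp add: ops)
  qed
qed

section \<open>Submodules \<open>L/N\<close> of \<open>M/N\<close> and the natural maps from
  \<open>M/N\<close> to \<open>M/L\<close>\<close>

lemma mem_quotient_submodule_iff:
  assumes N: "submodule N R M" and L: "submodule L R M" and NL: "N \<subseteq> L" and x: "x \<in> carrier M"
  shows "N +>\<^bsub>M\<^esub> x \<in> quotient_submodule M L N \<longleftrightarrow> x \<in> L"
proof
  assume "N +>\<^bsub>M\<^esub> x \<in> quotient_submodule M L N"
  then obtain y where y: "y \<in> L" "N +>\<^bsub>M\<^esub> x = N +>\<^bsub>M\<^esub> y" unfolding quotient_submodule_eq by blast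
  then have "x \<in> N +>\<^bsub>M\<^esub> y" using rcoset_self[OF N x] by simp
  then obtain n where "n \<in> N" "x = n \<oplus>\<^bsub>M\<^esub> y" unfolding a_r_coset_def' by auto
  then show "x \<in> L" using submodule_add[OF L] y NL by blast
qed (auto simp: quotient_submodule_eq)

text \<open>Each \<open>K i\<close> contains \<open>N\<close> and so is a union of cosets of
  \<open>N\<close>: any representative of a common coset lies in every \<open>K i\<close>.
  Non-emptiness of \<open>I\<close> supplies a representative.\<close>

lemma quotient_submodule_INT:
  assumes N: "submodule N R M" and "I \<noteq> {}"
    and K: "\<And>i. i \<in> I \<Longrightarrow> submodule (K i) R M" "\<And>i. i \<in> I \<Longrightarrow> N \<subseteq> K i"
  shows "(\<Inter>i\<in>I. quotient_submodule M (K i) N) = quotient_submodule M (\<Inter>i\<in>I. K i) N"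
proof (intro subset_antisym subsetI)
  fix A assume A: "A \<in> (\<Inter>i\<in>I. quotient_submodule M (K i) N)"
  obtain i where i: "i \<in> I" using assms(2) by blast
  then have "A \<in> quotient_submodule M (K i) N" using A by blast
  then obtain x where x: "A = N +>\<^bsub>M\<^esub> x" "x \<in> carrier M"
    using submodule_subset[OF K(1)[OF i]] unfolding quotient_submodule_eq by blast
  have "x \<in> K j" if "j \<in> I" for j
    using A x that mem_quotient_submodule_iff[OF N K(1)[OF that] K(2)[OF that] x(2)] by blast
  then show "A \<in> quotient_submodule M (\<Inter>i\<in>I. K i) N" using x unfolding quotient_submodule_eq by blast
next
  fix A assume "A \<in> quotient_submodule M (\<Inter>i\<in>I. K i) N"
  then show "A \<in> (\<Inter>i\<in>I. quotient_submodule M (K i) N)" unfolding quotient_submodule_eq by blast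
qed

lemma quotient_submodule_zero_iff:
  assumes N: "submodule N R M" and L: "submodule L R M" and NL: "N \<subseteq> L"
  shows "quotient_submodule M L N = {N} \<longleftrightarrow> L = N"
proof
  assume e: "quotient_submodule M L N = {N}"
  have "x \<in> N" if x: "x \<in> L" for x
  proof -
    have xc: "x \<in> carrier M" using x submodule_subset[OF L] by blast
    have "N +>\<^bsub>M\<^esub> x \<in> quotient_submodule M L N" using x unfolding quotient_submodule_eq by blast
    then show ?thesis using e rcoset_zero_iff[OF N xc] by simp
  qed
  then show "L = N" using NL by blast
next
  assume "L = N"
  moreover have "N +>\<^bsub>M\<^esub> x = N" if "x \<in> N" for x
    using rcoset_zero_iff[OF N, of x] that submodule_subset[OF N] by blast
  ultimately show "quotient_submodule M L N = {N}"
    using submodule_zero[OF N] unfolding quotient_submodule_eq by force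
qed

text \<open>The natural map is addition of \<open>L\<close> to a coset as a set, which involves no
  choice of representative: \<open>L + (N + x) = (L + N) + x = L + x\<close>. The condition defining
  the kernel has \<open>L\<close> on its right because \<open>L\<close> is the zero of
  \<open>M/L\<close>.\<close>

lemma quotient_projection:
  assumes N: "submodule N R M" and L: "submodule L R M" and NL: "N \<subseteq> L"
  shows "left_module_hom R (quotient_module M N) (quotient_module M L) (\<lambda>A. L <+>\<^bsub>M\<^esub> A)"
    and "{A \<in> carrier (quotient_module M N). L <+>\<^bsub>M\<^esub> A = L} = quotient_submodule M L N"
proof -
  interpret QN: left_module R "quotient_module M N" by (rule left_module_quotient[OF N])
  interpret QL: left_module R "quotient_module M L" by (rule left_module_quotient[OF L])
  have proj: "L <+>\<^bsub>M\<^esub> (N +>\<^bsub>M\<^esub> x) = L +>\<^bsub>M\<^esub> x" if "x \<in> carrier M" for x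
    using that M.a_setmult_rcos_assoc[of L N x] submodule_set_add_absorb[OF assms]
      submodule_subset[OF N] submodule_subset[OF L] by simp
  have ex: "\<exists>a\<in>carrier M. x = N +>\<^bsub>M\<^esub> a" if "x \<in> carrier (quotient_module M N)" for x
    using that unfolding carrier_quotient by blast
  show "left_module_hom R (quotient_module M N) (quotient_module M L) (\<lambda>A. L <+>\<^bsub>M\<^esub> A)"
  proof unfold_locales
    fix A assume "A \<in> carrier (quotient_module M N)"
    then obtain a where a: "a \<in> carrier M" "A = N +>\<^bsub>M\<^esub> a" using ex by blast
    show "L <+>\<^bsub>M\<^esub> A \<in> carrier (quotient_module M L)"
      using a proj unfolding carrier_quotient by auto
    show "L <+>\<^bsub>M\<^esub> (r \<odot>\<^bsub>quotient_module M N\<^esub> A) = r \<odot>\<^bsub>quotient_module M L\<^esub> (L <+>\<^bsub>M\<^esub> A)"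
      if "r \<in> carrier R" for r
      using that a by (simp add: smult_quotient N L proj)
    fix B assume "B \<in> carrier (quotient_module M N)"
    then obtain b where b: "b \<in> carrier M" "B = N +>\<^bsub>M\<^esub> b" using ex by blast
    show "L <+>\<^bsub>M\<^esub> (A \<oplus>\<^bsub>quotient_module M N\<^esub> B) =
        (L <+>\<^bsub>M\<^esub> A) \<oplus>\<^bsub>quotient_module M L\<^esub> (L <+>\<^bsub>M\<^esub> B)"
      using a b by (simp add: add_quotient N L proj)
  qed
  show "{A \<in> carrier (quotient_module M N). L <+>\<^bsub>M\<^esub> A = L} = quotient_submodule M L N"
  proof (intro subset_antisym subsetI)
    fix A assume A: "A \<in> {A \<in> carrier (quotient_module M N). L <+>\<^bsub>M\<^esub> A = L}"
    then obtain a where a: "a \<in> carrier M" "A = N +>\<^bsub>M\<^esub> a" using ex by blast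
    then have "a \<in> L" using A proj rcoset_zero_iff[OF L a(1)] by simp
    then show "A \<in> quotient_submodule M L N" using a unfolding quotient_submodule_eq by blast
  next
    fix A assume "A \<in> quotient_submodule M L N"
    then obtain a where a: "a \<in> L" "A = N +>\<^bsub>M\<^esub> a" unfolding quotient_submodule_eq by blast
    have ac: "a \<in> carrier M" using a submodule_subset[OF L] by blast
    then have "A \<in> carrier (quotient_module M N)" using a unfolding carrier_quotient by blast
    then show "A \<in> {A \<in> carrier (quotient_module M N). L <+>\<^bsub>M\<^esub> A = L}"
      using a ac proj rcoset_zero_iff[OF L ac] by simp
  qed
qed

lemma submodule_quotient_submodule:
  assumes N: "submodule N R M" and L: "submodule L R M" and NL: "N \<subseteq> L"
  shows "submodule (quotient_submodule M L N) R (quotient_module M N)"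
  using left_module_hom.kernel_submodule[OF quotient_projection(1)[OF assms]]
  by (simp add: quotient_projection(2)[OF assms])

text \<open>A submodule meeting the kernel \<open>L/N\<close> of the natural map in zero embeds in
  \<open>M/L\<close>. Cosets of \<open>N\<close> and of \<open>L\<close> have the same type, so the
  classes are comparable.\<close>

lemma As_quotient:
  assumes N: "submodule N R M" and L: "submodule L R M" and NL: "N \<subseteq> L"
    and U: "submodule U R (quotient_module M N)" "uniform_module R ((quotient_module M N)\<lparr>carrier := U\<rparr>)"
    and UL: "U \<inter> quotient_submodule M L N = {N}"
  shows "essential_class R ((quotient_module M N)\<lparr>carrier := U\<rparr>) \<in> As R (quotient_module M L)"
  using As_embedding[OF quotient_projection(1)[OF N L NL] U] UL
  by (simp add: quotient_projection(2)[OF N L NL])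

section \<open>Families separating the left primes\<close>

text \<open>If \<open>U\<close> met every \<open>K i\<close>, uniformity would make it meet their
  intersection, which is zero.\<close>

lemma uniform_separated:
  assumes U: "submodule U R M" "uniform_module R (M\<lparr>carrier := U\<rparr>)"
    and I: "finite I" "I \<noteq> {}"
    and K: "\<And>i. i \<in> I \<Longrightarrow> submodule (K i) R M" "(\<Inter>i\<in>I. K i) = {\<zero>\<^bsub>M\<^esub>}"
  obtains i where "i \<in> I" "U \<inter> K i = {\<zero>\<^bsub>M\<^esub>}"
proof (rule ccontr)
  assume "\<not> thesis"
  then have "\<And>i. i \<in> I \<Longrightarrow> U \<inter> K i \<noteq> {\<zero>\<^bsub>M\<^esub>}" using that by blast
  from uniform_Int_INT[OF U I(1) K(1) this]
  have "U \<inter> (\<Inter>i\<in>I. K i) \<noteq> {\<zero>\<^bsub>M\<^esub>}" ..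
  then show False using K(2) submodule_zero[OF U(1)] by simp
qed

text \<open>The hypothesis on classes abstracts from quotients: for \<open>K i = N_i/N\<close> it
  comes from the embedding of \<open>U\<close> in \<open>M/N_i\<close>. \<open>X\<close> may be
  constant, as it is when two primary submodules with the same left prime are intersected.\<close>

lemma As_subset_separated:
  assumes I: "finite I" "I \<noteq> {}"
    and K: "\<And>i. i \<in> I \<Longrightarrow> submodule (K i) R M" "(\<Inter>i\<in>I. K i) = {\<zero>\<^bsub>M\<^esub>}"
    and cls: "\<And>i U. \<lbrakk>i \<in> I; submodule U R M; uniform_module R (M\<lparr>carrier := U\<rparr>); U \<inter> K i = {\<zero>\<^bsub>M\<^esub>}\<rbrakk>
      \<Longrightarrow> essential_class R (M\<lparr>carrier := U\<rparr>) = X i"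
  shows "As R M \<subseteq> X ` I"
proof
  fix Y assume "Y \<in> As R M"
  then obtain U where U: "submodule U R M" "uniform_module R (M\<lparr>carrier := U\<rparr>)"
    "Y = essential_class R (M\<lparr>carrier := U\<rparr>)" unfolding As_def by blast
  obtain i where i: "i \<in> I" "U \<inter> K i = {\<zero>\<^bsub>M\<^esub>}"
    by (rule uniform_separated[OF U(1,2) I K])
  have "Y = X i" unfolding U(3) by (rule cls[OF i(1) U(1,2) i(2)])
  then show "Y \<in> X ` I" using i(1) by blast
qed

text \<open>As \<open>W j \<subseteq> K i\<close> for \<open>j \<noteq> i\<close>, the sum of these
  \<open>W j\<close> lies in \<open>K i\<close>, and directness reduces to \<open>W i\<close>
  meeting \<open>K i\<close> in zero. The factor \<open>carrier M\<close> makes \<open>W i\<close>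
  the whole module when \<open>s = 1\<close>, where the intersection over the empty set is
  \<open>UNIV\<close>.\<close>

lemma splitting_of_separating:
  fixes s :: nat and K :: "nat \<Rightarrow> 'm set"
  defines "W \<equiv> \<lambda>i. carrier M \<inter> (\<Inter>j\<in>{1..s}-{i}. K j)"
  assumes fin: "finite_uniform_dim R M" and s: "1 \<le> s" and inj: "inj_on X {1..s}"
    and K: "\<And>i. i \<in> {1..s} \<Longrightarrow> submodule (K i) R M" "(\<Inter>i\<in>{1..s}. K i) = {\<zero>\<^bsub>M\<^esub>}"
    and cls: "\<And>i U. \<lbrakk>i \<in> {1..s}; submodule U R M; uniform_module R (M\<lparr>carrier := U\<rparr>); U \<inter> K i = {\<zero>\<^bsub>M\<^esub>}\<rbrakk>
      \<Longrightarrow> essential_class R (M\<lparr>carrier := U\<rparr>) = X i"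
    and W_nz: "\<And>i. i \<in> {1..s} \<Longrightarrow> W i \<noteq> {\<zero>\<^bsub>M\<^esub>}"
  shows "essential_splitting R M s X W"
    and "\<And>i. i \<in> {1..s} \<Longrightarrow> W i \<inter> K i = {\<zero>\<^bsub>M\<^esub>}"
    and "\<And>i. i \<in> {1..s} \<Longrightarrow> submodule_sum M ({1..s} - {i}) W \<subseteq> K i"
    and "As R M = X ` {1..s}"
proof -
  have ne: "{1..s} \<noteq> {}" using s by simp
  have W: "submodule (W i) R M" for i
  proof (cases "{1..s} - {i} = {}")
    case True
    show ?thesis unfolding W_def True by (simp add: submodule_carrier)
  next
    case False
    then show ?thesis unfolding W_def
      by (intro submodule_Int submodule_carrier submodule_INT K(1)) auto
  qed
  show WK: "W i \<inter> K i = {\<zero>\<^bsub>M\<^esub>}" if i: "i \<in> {1..s}" for i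
  proof -
    have "(\<Inter>j\<in>{1..s}-{i}. K j) \<inter> K i = (\<Inter>j\<in>{1..s}. K j)" using i by blast
    then have "W i \<inter> K i = carrier M \<inter> {\<zero>\<^bsub>M\<^esub>}" using K(2) unfolding W_def by blast
    then show ?thesis by simp
  qed
  show sumK: "submodule_sum M ({1..s} - {i}) W \<subseteq> K i" if i: "i \<in> {1..s}" for i
    using i by (intro submodule_sum_least K(1)) (auto simp: W_def)
  have AsW: "As R (M\<lparr>carrier := W i\<rparr>) = {X i}" if i: "i \<in> {1..s}" for i
  proof -
    have "As R (M\<lparr>carrier := W i\<rparr>) \<subseteq> {X i}"
    proof
      fix Y assume "Y \<in> As R (M\<lparr>carrier := W i\<rparr>)"
      then obtain U where U: "submodule U R M" "U \<subseteq> W i" "uniform_module R (M\<lparr>carrier := U\<rparr>)"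
        "Y = essential_class R (M\<lparr>carrier := U\<rparr>)" unfolding As_restrict[OF W] by blast
      have "U \<inter> K i = {\<zero>\<^bsub>M\<^esub>}"
        using WK[OF i] U(2) submodule_zero[OF U(1)] submodule_zero[OF K(1)[OF i]] by blast
      then show "Y \<in> {X i}" using cls[OF i U(1,3)] U(4) by simp
    qed
    then show ?thesis using As_nonempty[OF fin W W_nz[OF i]] by blast
  qed
  have XAs: "X i \<in> As R M" if i: "i \<in> {1..s}" for i
  proof -
    have "As R (M\<lparr>carrier := W i\<rparr>) \<subseteq> As R M" unfolding As_restrict[OF W] unfolding As_def by blast
    then show ?thesis using AsW[OF i] by simp
  qed
  have "As R M \<subseteq> X ` {1..s}" using ne by (intro As_subset_separated[OF _ _ K cls]) auto
  then show "As R M = X ` {1..s}" using XAs by blast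
  have S: "submodule (submodule_sum M {1..s} W) R M" using W by (intro submodule_submodule_sum) auto
  have "direct_family M {1..s} W"
    unfolding direct_family_def
  proof
    fix i assume i: "i \<in> {1..s}"
    have "W i \<inter> submodule_sum M ({1..s} - {i}) W \<subseteq> {\<zero>\<^bsub>M\<^esub>}" using WK[OF i] sumK[OF i] by blast
    then show "W i \<inter> submodule_sum M ({1..s} - {i}) W = {\<zero>\<^bsub>M\<^esub>}"
      using submodule_zero[OF W] zero_in_submodule_sum by blast
  qed
  moreover have "essential_submodule R M (submodule_sum M {1..s} W)"
    unfolding essential_submodule_def
  proof (intro conjI allI impI S notI)
    fix L assume L: "submodule L R M \<and> L \<noteq> {\<zero>\<^bsub>M\<^esub>}" and SL: "submodule_sum M {1..s} W \<inter> L = {\<zero>\<^bsub>M\<^esub>}"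
    obtain U where U: "submodule U R M" "U \<subseteq> L" "uniform_module R (M\<lparr>carrier := U\<rparr>)"
      using uniform_submodule_exists[OF fin] L by blast
    obtain i where i: "i \<in> {1..s}" "U \<inter> K i = {\<zero>\<^bsub>M\<^esub>}"
      by (rule uniform_separated[OF U(1,3) finite_atLeastAtMost ne K])
    \<comment> \<open>Missing \<open>K j\<close> as well would give \<open>U\<close> both classes
      \<open>X i\<close> and \<open>X j\<close>, which are distinct. So \<open>U\<close> meets every
      \<open>K j\<close> with \<open>j \<noteq> i\<close>, hence also \<open>W i\<close>, which lies
      in a sum that was assumed to miss \<open>L\<close>.\<close>
    have other: "U \<inter> K j \<noteq> {\<zero>\<^bsub>M\<^esub>}" if j: "j \<in> {1..s} - {i}" for j
    proof
      assume "U \<inter> K j = {\<zero>\<^bsub>M\<^esub>}"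
      then have "X i = X j" using cls[OF i(1) U(1,3) i(2)] cls[of j U] j U by auto
      then show False using inj_onD[OF inj] i j by auto
    qed
    have Kj: "submodule (K j) R M" if "j \<in> {1..s} - {i}" for j using that K(1) by blast
    have "U \<inter> (\<Inter>j\<in>{1..s}-{i}. K j) \<noteq> {\<zero>\<^bsub>M\<^esub>}"
      by (intro conjunct2[OF uniform_Int_INT[OF U(1,3)]] finite_Diff finite_atLeastAtMost Kj other)
    moreover have "U \<inter> (\<Inter>j\<in>{1..s}-{i}. K j) = U \<inter> W i"
      using submodule_subset[OF U(1)] unfolding W_def by blast
    moreover have "U \<inter> W i \<subseteq> {\<zero>\<^bsub>M\<^esub>}"
      using SL U(2) submodule_sum_upper[of W i, OF W i(1)] by blast
    ultimately show False using submodule_zero[OF U(1)] submodule_zero[OF W] by blast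
  qed
  ultimately show "essential_splitting R M s X W"
    using W W_nz AsW unfolding essential_splitting_def by blast
qed

text \<open>
  A uniform submodule of \<open>Z \<inter> \<Sum>i\<in>F. W i\<close>, for a smallest \<open>F\<close> making this nonzero, embeds in
  \<open>W i\<close> for every \<open>i \<in> F\<close>, so \<open>F\<close> is a singleton.
\<close>

lemma splitting_meets:
  assumes fin: "finite_uniform_dim R M" and inj: "inj_on X {1..s}"
    and split: "essential_splitting R M s X W"
    and Z: "submodule Z R M" "Z \<noteq> {\<zero>\<^bsub>M\<^esub>}"
  obtains i where "i \<in> {1..s}" "Z \<inter> W i \<noteq> {\<zero>\<^bsub>M\<^esub>}"
proof -
  have W: "\<And>i. i \<in> {1..s} \<Longrightarrow> submodule (W i) R M"
    and dir: "direct_family M {1..s} W"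
    and ess: "essential_submodule R M (submodule_sum M {1..s} W)"
    and AsW: "\<And>i. i \<in> {1..s} \<Longrightarrow> As R (M\<lparr>carrier := W i\<rparr>) = {X i}"
    using split unfolding essential_splitting_def by blast+
  define P where "P F \<longleftrightarrow> F \<subseteq> {1..s} \<and> Z \<inter> submodule_sum M F W \<noteq> {\<zero>\<^bsub>M\<^esub>}" for F
  \<comment> \<open>Essentiality gives one index set satisfying \<open>P\<close>, so there is one
    with the fewest elements.\<close>
  have "P {1..s}" using ess Z unfolding P_def essential_submodule_def by (auto simp: Int_commute)
  then obtain F where F: "P F" and min: "\<And>G. P G \<Longrightarrow> card F \<le> card G"
    using exists_least_iff[of "\<lambda>n. \<exists>F. P F \<and> card F = n"] by (metis linorder_le_less_linear)
  have F_sub: "F \<subseteq> {1..s}" and finF: "finite F"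
    using F unfolding P_def by (auto intro: finite_subset)
  have WF: "\<And>i. i \<in> F \<Longrightarrow> submodule (W i) R M" using F_sub W by blast
  have S: "submodule (submodule_sum M F W) R M" by (rule submodule_submodule_sum[OF finF WF])
  have ZF: "Z \<inter> submodule_sum M F W \<noteq> {\<zero>\<^bsub>M\<^esub>}" using F unfolding P_def by blast
  obtain U where U: "submodule U R M" "U \<subseteq> Z \<inter> submodule_sum M F W" "uniform_module R (M\<lparr>carrier := U\<rparr>)"
    by (rule uniform_submodule_exists[OF fin submodule_Int[OF Z(1) S] ZF])
  have cls: "essential_class R (M\<lparr>carrier := U\<rparr>) = X i" if i: "i \<in> F" for i
  proof -
    let ?A = "submodule_sum M (F - {i}) W"
    have A: "submodule ?A R M" using finF WF by (intro submodule_submodule_sum) auto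
    \<comment> \<open>By minimality \<open>Z\<close>, and with it \<open>U\<close>, misses the sum
      over \<open>F - {i}\<close>, which is the kernel of the projection onto
      \<open>W i\<close>.\<close>
    have "\<not> P (F - {i})" using min[of "F - {i}"] card_Diff1_less[OF finF i] by linarith
    then have "Z \<inter> ?A = {\<zero>\<^bsub>M\<^esub>}" using F_sub unfolding P_def by blast
    then have "U \<inter> ?A = {\<zero>\<^bsub>M\<^esub>}" using U(2) submodule_zero[OF U(1)] submodule_zero[OF A] by blast
    moreover have "?A \<inter> W i = {\<zero>\<^bsub>M\<^esub>}"
    proof -
      have "?A \<subseteq> submodule_sum M ({1..s} - {i}) W" using F_sub by (intro submodule_sum_mono) blast
      then have "?A \<inter> W i \<subseteq> {\<zero>\<^bsub>M\<^esub>}"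
        using dir i F_sub unfolding direct_family_def by blast
      then show ?thesis using submodule_zero[OF A] submodule_zero[OF WF[OF i]] by blast
    qed
    moreover have "submodule_sum M F W = ?A <+>\<^bsub>M\<^esub> W i"
      using submodule_sum_insert[of i "F - {i}" W] WF i by (simp add: insert_absorb)
    ultimately have "essential_class R (M\<lparr>carrier := U\<rparr>) \<in> As R (M\<lparr>carrier := W i\<rparr>)"
      using U by (intro As_projection[OF A WF[OF i]]) auto
    then show ?thesis using AsW[of i] i F_sub by auto
  qed
  have "F \<noteq> {}" using ZF submodule_zero[OF Z(1)] by (auto simp: submodule_sum_empty)
  then obtain i where i: "i \<in> F" by blast
  have "j = i" if j: "j \<in> F" for j
  proof -
    have "j \<in> {1..s}" "i \<in> {1..s}" using i j F_sub by blast+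
    then show ?thesis using cls[OF i] cls[OF j] inj_onD[OF inj, of j i] by simp
  qed
  then have "W j \<subseteq> W i" if "j \<in> F" for j using that by blast
  then have "submodule_sum M F W \<subseteq> W i" by (rule submodule_sum_least[OF WF[OF i]])
  then have "U \<subseteq> Z \<inter> W i" using U(2) by blast
  then have "Z \<inter> W i \<noteq> {\<zero>\<^bsub>M\<^esub>}"
    using U(3) submodule_zero[OF U(1)] unfolding uniform_restrict_iff[OF U(1)] by blast
  then show ?thesis using that i F_sub by blast
qed

section \<open>Shortest primary decompositions\<close>

text \<open>Minimality is recast for sets of primary submodules, so that merging or dropping terms
  requires only counting and no reindexing.\<close>

lemma shortest_le_card:
  assumes "shortest_primary_decomposition R M N s Ns"
    and P: "finite P" "P \<noteq> {}" "\<And>L. L \<in> P \<Longrightarrow> primary_submodule R M L" "\<Inter>P = N"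
  shows "s \<le> card P"
proof -
  obtain h where h: "bij_betw h {1..card P} P" using ex_bij_betw_nat_finite_1[OF P(1)] by blast
  then have hP: "h ` {1..card P} = P" by (simp add: bij_betw_def)
  have "primary_decomposition R M N (card P) h"
    unfolding primary_decomposition_def
  proof (intro conjI ballI)
    show "1 \<le> card P" using P(1,2) by (simp add: Suc_le_eq card_gt_0_iff)
    show "primary_submodule R M (h i)" if "i \<in> {1..card P}" for i
      using that hP P(3) by blast
    show "N = (\<Inter>i\<in>{1..card P}. h i)" unfolding hP using P(4) by simp
  qed
  then show ?thesis using assms(1) unfolding shortest_primary_decomposition_def by blast
qed

text \<open>Modulo the intersection, a uniform submodule misses the submodule given by
  \<open>L1\<close> or that given by \<open>L2\<close>, hence embeds in \<open>M/L1\<close> or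
  \<open>M/L2\<close> and has class \<open>Y\<close>. The two submodules index their own family, so
  \<open>L1 = L2\<close> is covered.\<close>

lemma primary_submodule_Int:
  assumes uf: "uniformly_finite R M" and L: "submodule L1 R M" "submodule L2 R M"
    and Y: "As R (quotient_module M L1) = {Y}" "As R (quotient_module M L2) = {Y}"
  shows "primary_submodule R M (L1 \<inter> L2)"
proof -
  let ?N = "L1 \<inter> L2" and ?I = "{L1, L2}"
  have N: "submodule ?N R M" by (rule submodule_Int[OF L])
  have sub: "submodule L R M" "?N \<subseteq> L" "As R (quotient_module M L) = {Y}" if "L \<in> ?I" for L
    using that L Y by auto
  interpret Q: left_module R "quotient_module M ?N" by (rule left_module_quotient[OF N])
  have fin: "finite_uniform_dim R (quotient_module M ?N)"
    using uf N unfolding uniformly_finite_def by blast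
  have "(\<Inter>L\<in>?I. quotient_submodule M L ?N) = quotient_submodule M (\<Inter>L\<in>?I. L) ?N"
    using sub by (intro quotient_submodule_INT[OF N]) auto
  also have "\<dots> = {?N}" using quotient_submodule_zero_iff[OF N N] by simp
  finally have INT: "(\<Inter>L\<in>?I. quotient_submodule M L ?N) = {\<zero>\<^bsub>quotient_module M ?N\<^esub>}" by simp
  have "As R (quotient_module M ?N) \<subseteq> (\<lambda>_. Y) ` ?I"
  proof (rule Q.As_subset_separated[OF _ _ _ INT])
    fix L U assume L': "L \<in> ?I" and U: "submodule U R (quotient_module M ?N)"
      "uniform_module R ((quotient_module M ?N)\<lparr>carrier := U\<rparr>)"
      "U \<inter> quotient_submodule M L ?N = {\<zero>\<^bsub>quotient_module M ?N\<^esub>}"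
    show "essential_class R ((quotient_module M ?N)\<lparr>carrier := U\<rparr>) = Y"
      using As_quotient[OF N sub(1,2)[OF L'] U(1,2)] U(3) sub(3)[OF L'] by simp
  qed (use sub submodule_quotient_submodule[OF N] in auto)
  \<comment> \<open>A nonzero quotient has nonempty \<open>As\<close>. If it were zero,
    \<open>L1\<close> would be all of \<open>M\<close>, and the zero module \<open>M/L1\<close>
    would have no uniform submodule, although its \<open>As\<close> is \<open>{Y}\<close>.\<close>
  moreover have "carrier (quotient_module M ?N) \<noteq> {\<zero>\<^bsub>quotient_module M ?N\<^esub>}"
  proof
    assume "carrier (quotient_module M ?N) = {\<zero>\<^bsub>quotient_module M ?N\<^esub>}"
    then have "quotient_submodule M (carrier M) ?N = {?N}"
      unfolding quotient_submodule_eq carrier_quotient by simp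
    then have "carrier M = ?N"
      using quotient_submodule_zero_iff[OF N submodule_carrier submodule_subset[OF N]] by simp
    then have "L1 = carrier M" using submodule_subset[OF L(1)] by blast
    then have C: "carrier (quotient_module M L1) = {L1}"
      using quotient_submodule_zero_iff[OF L(1) L(1)]
      unfolding quotient_submodule_eq carrier_quotient by simp
    interpret Q1: left_module R "quotient_module M L1" by (rule left_module_quotient[OF L(1)])
    obtain U where "submodule U R (quotient_module M L1)"
      "uniform_module R ((quotient_module M L1)\<lparr>carrier := U\<rparr>)"
      using Y(1) unfolding As_def by blast
    then show False
      using Q1.submodule_subset[of U] Q1.submodule_zero[of U] C
      by (auto simp: Q1.uniform_restrict_iff)
  qed
  then have "As R ((quotient_module M ?N)\<lparr>carrier := carrier (quotient_module M ?N)\<rparr>) \<noteq> {}"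
    by (rule Q.As_nonempty[OF fin Q.submodule_carrier])
  then have "As R (quotient_module M ?N) \<noteq> {}" by simp
  ultimately have "As R (quotient_module M ?N) = {Y}" by auto
  then show ?thesis using N fin unfolding primary_submodule_def by blast
qed

lemma shortest_primary_inj:
  assumes uf: "uniformly_finite R M" and sh: "shortest_primary_decomposition R M N s Ns"
    and X: "\<And>i. i \<in> {1..s} \<Longrightarrow> As R (quotient_module M (Ns i)) = {X i}"
  shows "inj_on X {1..s}"
proof (rule inj_onI, rule ccontr)
  fix i j assume ij: "i \<in> {1..s}" "j \<in> {1..s}" "X i = X j" "i \<noteq> j"
  have prim: "\<And>k. k \<in> {1..s} \<Longrightarrow> primary_submodule R M (Ns k)" and N: "N = (\<Inter>k\<in>{1..s}. Ns k)"
    using sh unfolding shortest_primary_decomposition_def primary_decomposition_def by blast+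
  \<comment> \<open>Two terms with the same left prime are merged. This leaves at most
    \<open>1 + (s - 2) < s\<close> terms; coincidences among the \<open>Ns k\<close> only lower the
    count.\<close>
  let ?P = "insert (Ns i \<inter> Ns j) (Ns ` ({1..s} - {i, j}))"
  have "primary_submodule R M (Ns i \<inter> Ns j)"
    using ij prim X[of i] X[of j]
    by (intro primary_submodule_Int[OF uf, of _ _ "X i"]) (auto simp: primary_submodule_def)
  moreover have "\<Inter>?P = N" unfolding N using ij by auto
  ultimately have "s \<le> card ?P" using prim by (intro shortest_le_card[OF sh]) auto
  also have "\<dots> \<le> Suc (card (Ns ` ({1..s} - {i, j})))" by (rule card_insert_le_m1) auto
  also have "\<dots> \<le> Suc (card ({1..s} - {i, j}))" using card_image_le[of "{1..s} - {i, j}" Ns] by simp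
  also have "card ({1..s} - {i, j}) = s - 2" using ij by (subst card_Diff_subset) auto
  finally show False using ij by auto
qed

text \<open>Omitting a redundant term would leave at most \<open>s - 1\<close> terms. A primary
  decomposition has at least one term, so the case \<open>s = 1\<close> is excluded here.\<close>

lemma shortest_irredundant:
  assumes sh: "shortest_primary_decomposition R M N s Ns" and i: "i \<in> {1..s}" and s: "{1..s} - {i} \<noteq> {}"
  shows "(\<Inter>j\<in>{1..s} - {i}. Ns j) \<noteq> N"
proof
  assume e: "(\<Inter>j\<in>{1..s} - {i}. Ns j) = N"
  have prim: "\<And>k. k \<in> {1..s} \<Longrightarrow> primary_submodule R M (Ns k)"
    using sh unfolding shortest_primary_decomposition_def primary_decomposition_def by blast
  have "s \<le> card (Ns ` ({1..s} - {i}))"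
    using prim s e by (intro shortest_le_card[OF sh]) auto
  also have "\<dots> \<le> card ({1..s} - {i})" by (rule card_image_le) simp
  also have "\<dots> < s" using i by (simp add: card_Diff_subset)
  finally show False by simp
qed

end

section \<open>Translation between \<open>N\<close> in \<open>M\<close> and the zero submodule of
  \<open>M/N\<close>\<close>

theorem theorem5p3:
  fixes R :: "('r, 'x) ring_scheme" and M :: "('r, 'm) module"
    and N :: "'m set" and s :: nat and Ns :: "nat \<Rightarrow> 'm set"
    and X :: "nat \<Rightarrow> ('r, 'm set) module set"
  assumes "left_module R M"
    and "carrier M \<noteq> {\<zero>\<^bsub>M\<^esub>}"
    and "uniformly_finite R M"
    and "submodule N R M"
    and "N \<noteq> carrier M"
    and "shortest_primary_decomposition R M N s Ns"
    and "\<forall>i\<in>{1..s}. As R (quotient_module M (Ns i)) = {X i}"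
  shows
    "(\<exists>W. essential_splitting R (quotient_module M N) s X W \<and>
        (\<forall>i\<in>{1..s}. \<exists>C. complement_to R (quotient_module M N) (W i) C \<and>
           submodule_sum (quotient_module M N) ({1..s} - {i}) W \<subseteq> C \<and>
           submodule_sum (quotient_module M N) ({1..s} - {i}) W \<subseteq> quotient_submodule M (Ns i) N \<and>
           quotient_submodule M (Ns i) N \<subseteq> C))
     \<and> As R (quotient_module M N) = X ` {1..s}
     \<and> (\<forall>W' C' Ns'.
          essential_splitting R (quotient_module M N) s X W' \<and>
          (\<forall>i\<in>{1..s}. complement_to R (quotient_module M N) (W' i) (C' i) \<and>
             submodule_sum (quotient_module M N) ({1..s} - {i}) W' \<subseteq> C' i) \<and>
          (\<forall>i\<in>{1..s}. submodule (Ns' i) R M \<and> N \<subseteq> Ns' i \<and>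
             As R (quotient_module M (Ns' i)) = {X i} \<and>
             submodule_sum (quotient_module M N) ({1..s} - {i}) W' \<subseteq> quotient_submodule M (Ns' i) N \<and>
             quotient_submodule M (Ns' i) N \<subseteq> C' i)
          \<longrightarrow> shortest_primary_decomposition R M N s Ns')"
proof -
  interpret left_module R M by fact
  let ?Q = "quotient_module M N"
  note uf = assms(3) and N = assms(4) and sh = assms(6)
  have s: "1 \<le> s" and prim: "\<And>i. i \<in> {1..s} \<Longrightarrow> primary_submodule R M (Ns i)"
    and N_eq: "N = (\<Inter>i\<in>{1..s}. Ns i)"
    using sh unfolding shortest_primary_decomposition_def primary_decomposition_def by blast+
  have X: "\<And>i. i \<in> {1..s} \<Longrightarrow> As R (quotient_module M (Ns i)) = {X i}" using assms(7) by blast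
  have Ns: "\<And>i. i \<in> {1..s} \<Longrightarrow> submodule (Ns i) R M"
    using prim unfolding primary_submodule_def by blast
  have N_Ns: "\<And>i. i \<in> {1..s} \<Longrightarrow> N \<subseteq> Ns i" using N_eq by blast
  have ne: "{1..s} \<noteq> {}" using s by simp
  interpret Q: left_module R ?Q by (rule left_module_quotient[OF N])
  have fin: "finite_uniform_dim R ?Q" using uf N unfolding uniformly_finite_def by blast
  have inj: "inj_on X {1..s}" by (rule shortest_primary_inj[OF uf sh X])
  define K where "K i = quotient_submodule M (Ns i) N" for i
  have K: "\<And>i. i \<in> {1..s} \<Longrightarrow> submodule (K i) R ?Q"
    unfolding K_def by (rule submodule_quotient_submodule[OF N Ns N_Ns])
  have "(\<Inter>i\<in>{1..s}. K i) = quotient_submodule M N N"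
    unfolding K_def using quotient_submodule_INT[OF N ne Ns N_Ns] N_eq by simp
  then have INT: "(\<Inter>i\<in>{1..s}. K i) = {\<zero>\<^bsub>?Q\<^esub>}"
    using quotient_submodule_zero_iff[OF N N] by simp
  have cls: "essential_class R (?Q\<lparr>carrier := U\<rparr>) = X i"
    if i: "i \<in> {1..s}" and U: "submodule U R ?Q" "uniform_module R (?Q\<lparr>carrier := U\<rparr>)"
      "U \<inter> K i = {\<zero>\<^bsub>?Q\<^esub>}" for i U
    using As_quotient[OF N Ns[OF i] N_Ns[OF i] U(1,2)] U(3) X[OF i] unfolding K_def by simp
  define W where "W i = carrier ?Q \<inter> (\<Inter>j\<in>{1..s}-{i}. K j)" for i
  \<comment> \<open>For \<open>s = 1\<close>, \<open>W i\<close> is all of \<open>M/N\<close>, which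
    is nonzero since \<open>N\<close> is proper. Otherwise \<open>W i\<close> is the intersection of
    the other terms modulo \<open>N\<close>, nonzero because a shortest decomposition has no
    redundant term.\<close>
  have W_nz: "W i \<noteq> {\<zero>\<^bsub>?Q\<^esub>}" if i: "i \<in> {1..s}" for i
  proof (cases "{1..s} - {i} = {}")
    case True
    have "quotient_submodule M (carrier M) N \<noteq> {N}"
      using quotient_submodule_zero_iff[OF N submodule_carrier submodule_subset[OF N]] assms(5) by simp
    then show ?thesis unfolding W_def True quotient_submodule_eq carrier_quotient by simp
  next
    case False
    let ?J = "{1..s} - {i}"
    have J: "\<And>j. j \<in> ?J \<Longrightarrow> submodule (Ns j) R M" "\<And>j. j \<in> ?J \<Longrightarrow> N \<subseteq> Ns j" "\<And>j. j \<in> ?J \<Longrightarrow> K j \<subseteq> carrier ?Q"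
      using Ns N_Ns Q.submodule_subset[OF K] by blast+
    have "W i = (\<Inter>j\<in>?J. K j)" unfolding W_def using False J(3) by blast
    also have "\<dots> = quotient_submodule M (\<Inter>j\<in>?J. Ns j) N"
      unfolding K_def by (rule quotient_submodule_INT[OF N False J(1,2)])
    finally have Wi: "W i = quotient_submodule M (\<Inter>j\<in>?J. Ns j) N" .
    have "N \<subseteq> (\<Inter>j\<in>?J. Ns j)" using J(2) by blast
    then show ?thesis
      using quotient_submodule_zero_iff[OF N submodule_INT[OF False J(1)]]
        shortest_irredundant[OF sh i False] unfolding Wi by simp
  qed
  note splitting = Q.splitting_of_separating[OF fin s inj K INT cls W_nz[unfolded W_def], folded W_def]
  have W: "essential_splitting R ?Q s X W" by (rule splitting(1))
  have WK: "\<And>i. i \<in> {1..s} \<Longrightarrow> W i \<inter> K i = {\<zero>\<^bsub>?Q\<^esub>}" by (rule splitting(2))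
  have sumK: "\<And>i. i \<in> {1..s} \<Longrightarrow> submodule_sum ?Q ({1..s} - {i}) W \<subseteq> K i" by (rule splitting(3))
  have AsQ: "As R ?Q = X ` {1..s}" by (rule splitting(4))
  have "\<exists>C. complement_to R ?Q (W i) C \<and> submodule_sum ?Q ({1..s} - {i}) W \<subseteq> C \<and>
      submodule_sum ?Q ({1..s} - {i}) W \<subseteq> K i \<and> K i \<subseteq> C" if i: "i \<in> {1..s}" for i
  proof -
    have "submodule (W i) R ?Q" using W i unfolding essential_splitting_def by blast
    \<comment> \<open>Chosen above \<open>K i\<close>, this complement also contains the sum of the
      other \<open>W j\<close>, which lies in \<open>K i\<close>.\<close>
    then obtain C where C: "complement_to R ?Q (W i) C" "K i \<subseteq> C"
      by (rule Q.complement_exists[OF _ K[OF i] WK[OF i]])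
    then show ?thesis using sumK[OF i] by blast
  qed
  then have part1: "\<exists>W. essential_splitting R ?Q s X W \<and>
      (\<forall>i\<in>{1..s}. \<exists>C. complement_to R ?Q (W i) C \<and>
         submodule_sum ?Q ({1..s} - {i}) W \<subseteq> C \<and>
         submodule_sum ?Q ({1..s} - {i}) W \<subseteq> quotient_submodule M (Ns i) N \<and>
         quotient_submodule M (Ns i) N \<subseteq> C)"
    using W unfolding K_def by blast
  have converse: "shortest_primary_decomposition R M N s Ns'"
    if split: "essential_splitting R ?Q s X W'"
      and C': "\<And>i. i \<in> {1..s} \<Longrightarrow> complement_to R ?Q (W' i) (C' i)"
      and Ns': "\<And>i. i \<in> {1..s} \<Longrightarrow> submodule (Ns' i) R M" "\<And>i. i \<in> {1..s} \<Longrightarrow> N \<subseteq> Ns' i"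
        "\<And>i. i \<in> {1..s} \<Longrightarrow> As R (quotient_module M (Ns' i)) = {X i}"
        "\<And>i. i \<in> {1..s} \<Longrightarrow> quotient_submodule M (Ns' i) N \<subseteq> C' i" for W' C' Ns'
  proof -
    let ?L = "\<Inter>i\<in>{1..s}. Ns' i"
    let ?Z = "quotient_submodule M ?L N"
    have L: "submodule ?L R M" by (rule submodule_INT[OF ne Ns'(1)])
    have NL: "N \<subseteq> ?L" using Ns'(2) by blast
    have Z: "submodule ?Z R ?Q" by (rule submodule_quotient_submodule[OF N L NL])
    \<comment> \<open>\<open>?Z\<close> lies in each \<open>Ns' i\<close> modulo \<open>N\<close>,
      hence in \<open>C' i\<close>, and a complement of \<open>W' i\<close> meets it in
      zero.\<close>
    have ZW: "?Z \<inter> W' i = {\<zero>\<^bsub>?Q\<^esub>}" if i: "i \<in> {1..s}" for i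
    proof -
      have "?Z \<subseteq> quotient_submodule M (Ns' i) N" using i unfolding quotient_submodule_eq by blast
      then have "?Z \<inter> W' i \<subseteq> {\<zero>\<^bsub>?Q\<^esub>}" using Ns'(4)[OF i] C'[OF i] unfolding complement_to_def by blast
      moreover have "submodule (W' i) R ?Q" using split i unfolding essential_splitting_def by blast
      ultimately show ?thesis using Q.submodule_zero Z by blast
    qed
    \<comment> \<open>A nonzero \<open>?Z\<close> would meet some \<open>W' i\<close> nontrivially;
      here the distinctness of the \<open>X i\<close> enters the converse.\<close>
    have "?Z = {\<zero>\<^bsub>?Q\<^esub>}"
    proof (rule ccontr)
      assume "?Z \<noteq> {\<zero>\<^bsub>?Q\<^esub>}"
      then obtain i where "i \<in> {1..s}" "?Z \<inter> W' i \<noteq> {\<zero>\<^bsub>?Q\<^esub>}"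
        by (rule Q.splitting_meets[OF fin inj split Z])
      then show False using ZW by simp
    qed
    then have "N = ?L" using quotient_submodule_zero_iff[OF N L NL] by simp
    moreover have "primary_submodule R M (Ns' i)" if "i \<in> {1..s}" for i
      using Ns'(1,3)[OF that] uf unfolding primary_submodule_def uniformly_finite_def by blast
    \<comment> \<open>The new decomposition has \<open>s\<close> terms, as many as the given
      shortest one, so it is shortest too.\<close>
    ultimately show ?thesis
      using sh s unfolding shortest_primary_decomposition_def primary_decomposition_def by blast
  qed
  show ?thesis
  proof (rule conjI[OF part1 conjI[OF AsQ]], intro allI impI, elim conjE)
    fix W' C' Ns'
    assume "essential_splitting R ?Q s X W'"
      and "\<forall>i\<in>{1..s}. complement_to R ?Q (W' i) (C' i) \<and>
        submodule_sum ?Q ({1..s} - {i}) W' \<subseteq> C' i"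
      and "\<forall>i\<in>{1..s}. submodule (Ns' i) R M \<and> N \<subseteq> Ns' i \<and>
        As R (quotient_module M (Ns' i)) = {X i} \<and>
        submodule_sum ?Q ({1..s} - {i}) W' \<subseteq> quotient_submodule M (Ns' i) N \<and>
        quotient_submodule M (Ns' i) N \<subseteq> C' i"
    then show "shortest_primary_decomposition R M N s Ns'"
      by (intro converse[of W' C' Ns']) simp_all
  qed
qed

end
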